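(* Let $k_G^{\mathbb{C}} := 4/\pi$. For every natural number $n$ there exists a minimal positive real number $c_n$, satisfying $c_n \leq \sqrt{k_G^{\mathbb{C}}}$, such that for every natural number $m$ and every $X \in M_{(m,n)}(\mathbb{C})$ there exist a natural number $l \leq n^2$, a matrix $C \in M_{(m,l)}(\mathbb{C})$ with $\|C\|_\infty \leq c_n \|X\|_c$, a unit vector $\Lambda = (\lambda_1,\dots,\lambda_l) \in \mathbb{C}^l$ (with respect to the Euclidean norm) with positive entries, and a matrix $Z \in M_{(l,n)}(\mathbb{T})$ such that $$X = C\,\Delta(\Lambda)\,Z.$$ Moreover, $\sup\{c_n : n \in \mathbb{N}\} = \sqrt{k_G^{\mathbb{C}}}$.
   Context: $M_{(m,n)}(\mathbb{C})$ denotes the complex $m\times n$ matrices; $\mathbb{T}$ is the unit circle in $\mathbb{C}$ and $M_{(l,n)}(\mathbb{T})$ is the set of $l\times n$ matrices with all entries in $\mathbb{T}$. $\|C\|_\infty$ is the operator norm of $C$ (with respect to Euclidean norms). The column norm of $X$ is $\|X\|_c := \max_j \|X_j\|_2$, where $X_j$ is the $j$-th column of $X$. For $\Lambda \in \mathbb{C}^l$, $\Delta(\Lambda)$ is the diagonal $l \times l$ matrix with diagonal entries from $\Lambda$. *)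

theory Defs
  imports "Jordan_Normal_Form.Matrix" "HOL-Analysis.L2_Norm"
begin

definition l2_norm_vec :: "complex vec \<Rightarrow> real" where
  "l2_norm_vec v = L2_set (\<lambda>i. cmod (v $ i)) {..<dim_vec v}"

(* The type-indexed onorm does not apply to matrices whose size is a value.  The supremum is
   over the closed unit ball, a nonempty set on which the values are bounded. *)
definition op_norm_mat :: "complex mat \<Rightarrow> real" where
  "op_norm_mat C =
     (SUP v \<in> {v \<in> carrier_vec (dim_col C). l2_norm_vec v \<le> 1}. l2_norm_vec (C *\<^sub>v v))"

(* Only meaningful for matrices with at least one column. *)
definition column_norm :: "complex mat \<Rightarrow> real" where
  "column_norm X = Max ((\<lambda>j. l2_norm_vec (col X j)) ` {..<dim_col X})"

definition Delta :: "complex vec \<Rightarrow> complex mat" where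
  "Delta \<Lambda> = mat_diag (dim_vec \<Lambda>) (\<lambda>i. \<Lambda> $ i)"

definition torus_mat :: "nat \<Rightarrow> nat \<Rightarrow> complex mat set" where
  "torus_mat l n = {Z \<in> carrier_mat l n. \<forall>i<l. \<forall>j<n. cmod (Z $$ (i, j)) = 1}"

definition positive_vec :: "complex vec \<Rightarrow> bool" where
  "positive_vec \<Lambda> \<longleftrightarrow> (\<forall>i<dim_vec \<Lambda>. \<Lambda> $ i \<in> \<real> \<and> 0 < Re (\<Lambda> $ i))"

definition kGC :: real where
  "kGC = 4 / pi"

(* c is an admissible constant for matrices with n columns, uniformly in the number m of rows.
   The requirement that Lambda be a unit vector forces l to be nonzero. *)
definition factorization_constant :: "nat \<Rightarrow> real \<Rightarrow> bool" where
  "factorization_constant n c \<longleftrightarrow>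
     (\<forall>m\<ge>1. \<forall>X \<in> carrier_mat m n.
        \<exists>l \<le> n\<^sup>2. \<exists>C \<in> carrier_mat m l. \<exists>\<Lambda> \<in> carrier_vec l. \<exists>Z \<in> torus_mat l n.
          op_norm_mat C \<le> c * column_norm X \<and>
          l2_norm_vec \<Lambda> = 1 \<and> positive_vec \<Lambda> \<and>
          X = C * Delta \<Lambda> * Z)"

end

theory Submission
  imports Defs "HOL-Probability.Probability" "HOL-Real_Asymp.Real_Asymp"
begin

text \<open>
  Write \<open>x\<^sub>1, \<dots>, x\<^sub>n\<close> for the columns of \<open>X\<close>. A factorisation \<open>X = C \<Delta>(\<Lambda>) Z\<close> with
  \<open>\<parallel>C\<parallel> \<le> K\<close> exists if and only if the quadratic form \<open>\<parallel>X a\<parallel>\<^sup>2\<close> lies below \<open>K\<^sup>2 q(a)\<close>, where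
  \<open>q(a) = \<Sum>\<^sub>i \<lambda>\<^sub>i\<^sup>2 \<bar>\<Sum>\<^sub>j a\<^sub>j z\<^sub>i\<^sub>j\<bar>\<^sup>2 = \<parallel>\<Delta>(\<Lambda>) Z a\<parallel>\<^sup>2\<close>. If \<open>C\<close> is given this is the definition of the
  operator norm; conversely the inequality says that \<open>X a\<close> is a function of \<open>\<Delta>(\<Lambda>) Z a\<close> of norm at
  most \<open>K\<close>, so \<open>C\<close> can be defined on the range of \<open>\<Delta>(\<Lambda>) Z\<close> and extended by zero on its
  orthogonal complement (\<open>contractive_generalized_inverse\<close>). The question is therefore which
  multiples of a form in the convex hull of \<open>a \<mapsto> \<bar>\<Sum>\<^sub>j a\<^sub>j z\<^sub>j\<bar>\<^sup>2\<close>, with \<open>z\<close> in the torus, dominate a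
  given form. The hull lies in an affine hyperplane of the \<open>n\<^sup>2\<close>-dimensional real space of
  Hermitian forms, since every form has the value 1 at the standard basis vectors, so \<open>n\<^sup>2\<close>
  points of the torus suffice (\<open>torus_form_caratheodory\<close>), and it is compact, so that the
  infimum of the admissible constants is admissible (\<open>torus_form_limit\<close>, \<open>dominates_limit\<close>).

  Both halves of \<open>sup c\<^sub>n = sqrt (4 / pi)\<close> come from a standard Gaussian vector \<open>g\<close> in
  \<open>\<complex>\<^sup>N\<close>, for which \<open>E \<bar>\<langle>g, \<xi>\<rangle>\<bar> = \<kappa> \<parallel>\<xi>\<parallel>\<close> with \<open>\<kappa> = sqrt pi / 2\<close>.

  For the upper bound, differentiate this identity at a unit vector \<open>x\<close>: if \<open>u\<^sub>x\<close> is the unimodular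
  number with \<open>\<langle>g, x\<rangle> u\<^sub>x = \<bar>\<langle>g, x\<rangle>\<bar>\<close>, then \<open>E Re (\<langle>g, \<xi>\<rangle> u\<^sub>x) = \<kappa> Re \<langle>x, \<xi>\<rangle>\<close>. Applied to
  all columns and combined with the Cauchy-Schwarz inequality and \<open>E \<bar>\<langle>g, \<xi>\<rangle>\<bar>\<^sup>2 = \<parallel>\<xi>\<parallel>\<^sup>2\<close>,
  this gives \<open>\<kappa> \<parallel>X a\<parallel> \<le> (E \<bar>\<Sum>\<^sub>j a\<^sub>j u\<^sub>j\<bar>\<^sup>2)\<^sup>1\<^sup>/\<^sup>2\<close>, where \<open>(u\<^sub>1, \<dots>, u\<^sub>n)\<close> is a random point of the torus.
  This is domination with \<open>K = 1 / \<kappa> = sqrt (4 / pi)\<close>.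

  For the lower bound, let the columns of \<open>X\<close> be the normalised vectors \<open>y\<^sub>j / \<parallel>y\<^sub>j\<parallel>\<close> in \<open>\<complex>\<^sup>N\<close>, where
  \<open>\<Sum>\<^sub>j \<bar>\<langle>y\<^sub>j, \<xi>\<rangle>\<bar> \<le> \<beta> \<parallel>\<xi>\<parallel>\<close> for all \<open>\<xi>\<close>. Testing domination on the \<open>N\<close> vectors of conjugated
  coordinates of the \<open>y\<^sub>j\<close> and adding up yields \<open>\<Sum>\<^sub>j \<parallel>y\<^sub>j\<parallel> \<le> sqrt N * c * \<beta>\<close>. A finite sample
  of \<open>g\<close>, weighted by probabilities, has \<open>\<beta>\<close> close to \<open>\<kappa>\<close> and \<open>\<Sum>\<^sub>j \<parallel>y\<^sub>j\<parallel>\<close> close to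
  \<open>E \<parallel>g\<parallel> \<ge> sqrt N (1 - 1 / (2 N))\<close>, which forces \<open>c \<ge> 1 / \<kappa>\<close> in the limit.

  Only finitely supported distributions can be used as columns of a matrix or as weights on the
  torus; \<open>gaussian_discretisation\<close> supplies them for both purposes.
\<close>

section \<open>Convex combinations of rank-one forms on the torus\<close>

text \<open>
  Gaussian elimination on one equation at a time: an equation with a nonzero coefficient expresses
  one unknown through the others, which keeps the surplus of unknowns over equations.
\<close>

lemma homogeneous_system_nontrivial:
  fixes A :: "'i \<Rightarrow> 'j \<Rightarrow> real"
  assumes "finite I" "finite J" "card I < card J"
  shows "\<exists>\<mu>. (\<exists>j\<in>J. \<mu> j \<noteq> 0) \<and> (\<forall>i\<in>I. (\<Sum>j\<in>J. A i j * \<mu> j) = 0)"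
  using assms
proof (induction I arbitrary: J A rule: finite_induct)
  case empty
  then show ?case by (intro exI[of _ "\<lambda>_. 1"]) (auto simp: card_gt_0_iff)
next
  case (insert i I)
  show ?case
  proof (cases "\<forall>j\<in>J. A i j = 0")
    case True
    have "card I < card J" using insert by simp
    from insert.IH[OF insert.prems(1) this, of A] obtain \<mu>
      where "\<exists>j\<in>J. \<mu> j \<noteq> 0" "\<forall>k\<in>I. (\<Sum>j\<in>J. A k j * \<mu> j) = 0" by blast
    with True show ?thesis by (intro exI[of _ \<mu>]) simp
  next
    case False
    then obtain j0 where j0: "j0 \<in> J" "A i j0 \<noteq> 0" by auto
    let ?J = "J - {j0}"
    let ?A = "\<lambda>k j. A k j - A k j0 * A i j / A i j0"
    have "card I < card ?J" using insert j0 by (simp add: card_Diff_singleton)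
    from insert.IH[OF _ this, of ?A] insert.prems obtain \<mu>
      where \<mu>: "\<exists>j\<in>?J. \<mu> j \<noteq> 0" "\<forall>k\<in>I. (\<Sum>j\<in>?J. ?A k j * \<mu> j) = 0" by auto
    define s where "s = (\<Sum>j\<in>?J. A i j * \<mu> j)"
    define \<nu> where "\<nu> = (\<lambda>j. if j = j0 then - s / A i j0 else \<mu> j)"
    have split: "(\<Sum>j\<in>J. A k j * \<nu> j) = - A k j0 * s / A i j0 + (\<Sum>j\<in>?J. A k j * \<mu> j)" for k
      using insert.prems j0 by (subst sum.remove[of J j0]) (auto simp: \<nu>_def intro!: sum.cong)
    have "(\<Sum>j\<in>J. A k j * \<nu> j) = 0" if "k \<in> I" for k
    proof -
      have "0 = (\<Sum>j\<in>?J. ?A k j * \<mu> j)" using \<mu>(2) that by simp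
      also have "\<dots> = (\<Sum>j\<in>?J. A k j * \<mu> j) - A k j0 / A i j0 * s"
        by (simp add: s_def sum_distrib_left sum_subtractf[symmetric] algebra_simps)
      finally show ?thesis unfolding split by simp
    qed
    moreover have "(\<Sum>j\<in>J. A i j * \<nu> j) = 0"
      unfolding split using j0 by (simp add: s_def)
    moreover have "\<exists>j\<in>J. \<nu> j \<noteq> 0" using \<mu>(1) by (auto simp: \<nu>_def)
    ultimately show ?thesis by (intro exI[of _ \<nu>]) auto
  qed
qed

text \<open>
  The atoms are indexed by an arbitrary finite set \<open>V\<close>, because they will be sample points of a random
  vector before they are renumbered as the rows of \<open>Z\<close>.
\<close>

definition torus_form :: "nat \<Rightarrow> 'v set \<Rightarrow> ('v \<Rightarrow> real) \<Rightarrow> ('v \<Rightarrow> nat \<Rightarrow> complex) \<Rightarrow> (nat \<Rightarrow> complex) \<Rightarrow> real" where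
  "torus_form n V p z a = (\<Sum>v\<in>V. p v * (cmod (\<Sum>j<n. a j * z v j))\<^sup>2)"

definition torus_weights :: "nat \<Rightarrow> 'v set \<Rightarrow> ('v \<Rightarrow> real) \<Rightarrow> ('v \<Rightarrow> nat \<Rightarrow> complex) \<Rightarrow> bool" where
  "torus_weights n V p z \<longleftrightarrow> finite V \<and> (\<forall>v\<in>V. 0 \<le> p v) \<and> sum p V = 1 \<and>
     (\<forall>v\<in>V. \<forall>j<n. cmod (z v j) = 1)"

text \<open>
  The Hermitian matrix \<open>H\<^sub>j\<^sub>k = \<Sum>\<^sub>v \<mu>\<^sub>v z\<^sub>v\<^sub>j cnj z\<^sub>v\<^sub>k\<close> of the form is determined by the
  \<open>n\<^sup>2\<close> real numbers \<open>Re H\<^sub>j\<^sub>k + Im H\<^sub>j\<^sub>k\<close>: exchanging \<open>j\<close> and \<open>k\<close> changes the sign of the imaginary part.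
  This is where the bound \<open>l \<le> n\<^sup>2\<close> comes from.
\<close>

lemma torus_form_eq_zero:
  fixes z :: "'v \<Rightarrow> nat \<Rightarrow> complex"
  assumes "\<And>j k. j < n \<Longrightarrow> k < n \<Longrightarrow>
    (\<Sum>v\<in>V. (Re (z v j * cnj (z v k)) + Im (z v j * cnj (z v k))) * \<mu> v) = 0"
  shows "torus_form n V \<mu> z a = 0"
proof -
  define H where "H = (\<lambda>j k. \<Sum>v\<in>V. of_real (\<mu> v) * (z v j * cnj (z v k)))"
  have cnjH: "H k j = cnj (H j k)" for j k
    by (simp add: H_def mult_ac)
  have ReIm: "Re (H j k) + Im (H j k) = 0" if "j < n" "k < n" for j k
    using assms[OF that] by (simp add: H_def sum.distrib[symmetric] algebra_simps)
  have H0: "H j k = 0" if "j < n" "k < n" for j k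
  proof -
    have "Re (H j k) = Re (H k j)" "Im (H j k) = - Im (H k j)"
      by (simp_all add: cnjH[of j k])
    then show ?thesis using ReIm[OF that] ReIm[OF that(2,1)] by (simp add: complex_eq_iff)
  qed
  have "complex_of_real (torus_form n V \<mu> z a)
      = (\<Sum>v\<in>V. of_real (\<mu> v) * ((\<Sum>j<n. a j * z v j) * cnj (\<Sum>j<n. a j * z v j)))"
    unfolding torus_form_def complex_norm_square[symmetric] by simp
  also have "\<dots> = (\<Sum>v\<in>V. \<Sum>j<n. \<Sum>k<n. a j * cnj (a k) * (of_real (\<mu> v) * (z v j * cnj (z v k))))"
    by (simp add: sum_product) (simp add: sum_distrib_left mult_ac)
  also have "\<dots> = (\<Sum>j<n. \<Sum>k<n. a j * cnj (a k) * H j k)"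
    unfolding H_def sum_distrib_left
    by (subst sum.swap, rule sum.cong[OF refl], subst sum.swap) simp
  also have "\<dots> = 0" using H0 by simp
  finally show ?thesis by simp
qed

text \<open>
  Evaluation at the first unit vector recovers the total weight, so equality of forms already
  preserves the normalisation.
\<close>

lemma torus_form_unit:
  assumes "n \<ge> 1" "\<forall>v\<in>V. \<forall>j<n. cmod (z v j) = 1"
  shows "torus_form n V p z (\<lambda>j. if j = 0 then 1 else 0) = sum p V"
proof -
  have "(\<Sum>j<n. (if j = 0 then 1 else 0) * z v j) = z v 0" for v
    using assms(1) by (subst sum.remove[of _ 0]) auto
  then show ?thesis using assms by (simp add: torus_form_def)
qed

text \<open>
  More than \<open>n\<^sup>2\<close> atoms satisfy a linear relation \<open>\<mu>\<close> between their rank-one forms. Its weights add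
  up to zero, so some of them are positive, and moving \<open>p\<close> along \<open>- \<mu>\<close> until the first weight vanishes
  removes an atom without changing the form.
\<close>

lemma torus_form_caratheodory:
  fixes z :: "'v \<Rightarrow> nat \<Rightarrow> complex"
  assumes "torus_weights n V p z" and n: "n \<ge> 1"
  shows "\<exists>S p'. S \<subseteq> V \<and> card S \<le> n\<^sup>2 \<and> (\<forall>v\<in>S. 0 < p' v) \<and> torus_weights n S p' z \<and>
           (\<forall>a. torus_form n S p' z a = torus_form n V p z a)"
proof -
  have "finite V" using assms by (simp add: torus_weights_def)
  then show ?thesis using assms(1)
  proof (induction V arbitrary: p rule: finite_psubset_induct)
    case (psubset V)
    then have fin: "finite V" and p0: "\<forall>v\<in>V. 0 \<le> p v" and p1: "sum p V = 1"
      and z: "\<forall>v\<in>V. \<forall>j<n. cmod (z v j) = 1" by (auto simp: torus_weights_def)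
    have drop: ?case if "v0 \<in> V" "q v0 = 0" "\<forall>v\<in>V. 0 \<le> q v"
      "\<forall>a. torus_form n V q z a = torus_form n V p z a" for v0 q
    proof -
      have red: "torus_form n (V - {v0}) q z a = torus_form n V p z a" for a
        using that fin by (simp add: torus_form_def sum.remove[of V v0] flip: that(4))
      have "sum q (V - {v0}) = sum p V"
        using torus_form_unit[OF n, of "V - {v0}" z q] torus_form_unit[OF n, of V z p] red z
        by auto
      then have "torus_weights n (V - {v0}) q z" using fin that z p1 by (auto simp: torus_weights_def)
      moreover have "V - {v0} \<subset> V" using that by auto
      ultimately obtain S p' where S: "S \<subseteq> V - {v0} \<and> card S \<le> n\<^sup>2 \<and> (\<forall>v\<in>S. 0 < p' v) \<and>
          torus_weights n S p' z \<and> (\<forall>a. torus_form n S p' z a = torus_form n (V - {v0}) q z a)"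
        using psubset.IH[of "V - {v0}" q] by metis
      show ?thesis
        by (rule exI[of _ S], rule exI[of _ p']) (use S red in auto)
    qed
    consider "card V \<le> n\<^sup>2" "\<forall>v\<in>V. p v \<noteq> 0" | v0 where "v0 \<in> V" "p v0 = 0" | "card V > n\<^sup>2" by force
    then show ?case
    proof cases
      case 1
      then show ?thesis using psubset.prems p0
        by (intro exI[of _ V] exI[of _ p]) (auto simp: less_le)
    next
      case 2
      then show ?thesis using drop[of v0 p] p0 by auto
    next
      case 3
      let ?I = "{..<n} \<times> {..<n}"
      let ?A = "\<lambda>(j,k) v. Re (z v j * cnj (z v k)) + Im (z v j * cnj (z v k))"
      obtain \<mu> where \<mu>: "\<exists>v\<in>V. \<mu> v \<noteq> 0" "\<forall>i\<in>?I. (\<Sum>v\<in>V. ?A i v * \<mu> v) = 0"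
        using homogeneous_system_nontrivial[of ?I V ?A] 3 fin
        by (auto simp: power2_eq_square)
      have zero: "torus_form n V \<mu> z a = 0" for a
        by (rule torus_form_eq_zero) (use \<mu>(2) in auto)
      have "sum \<mu> V = 0" using torus_form_unit[OF n, of V z \<mu>] z zero by simp
      have "\<exists>v\<in>V. 0 < \<mu> v"
      proof (rule ccontr)
        assume "\<not> ?thesis"
        then have "\<forall>v\<in>V. 0 \<le> - \<mu> v" by force
        then have "\<forall>v\<in>V. - \<mu> v = 0"
          using sum_nonneg_eq_0_iff[OF fin, of "\<lambda>v. - \<mu> v"] \<open>sum \<mu> V = 0\<close> by (simp add: sum_negf)
        then show False using \<mu>(1) by auto
      qed
      let ?P = "{v\<in>V. 0 < \<mu> v}"
      \<comment> \<open>the largest step that keeps all weights nonnegative\<close>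
      define t where "t = Min ((\<lambda>v. p v / \<mu> v) ` ?P)"
      have ne: "?P \<noteq> {}" and fP: "finite ?P" using \<open>\<exists>v\<in>V. 0 < \<mu> v\<close> fin by auto
      have "t \<in> (\<lambda>v. p v / \<mu> v) ` ?P" unfolding t_def using ne fP by (intro Min_in) auto
      then obtain v0 where v0: "v0 \<in> V" "0 < \<mu> v0" "t = p v0 / \<mu> v0" by auto
      have t_le: "t \<le> p v / \<mu> v" if "v \<in> V" "0 < \<mu> v" for v
        unfolding t_def using that fP by (intro Min_le) auto
      have "0 \<le> t" using v0 p0 by simp
      define q where "q = (\<lambda>v. p v - t * \<mu> v)"
      have "0 \<le> q v" if "v \<in> V" for v
      proof (cases "0 < \<mu> v")
        case True
        then show ?thesis using t_le[OF that True] by (simp add: q_def pos_le_divide_eq)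
      next
        case False
        then have "t * \<mu> v \<le> 0" using \<open>0 \<le> t\<close> by (simp add: mult_nonneg_nonpos)
        then show ?thesis using p0 that by (simp add: q_def) (meson order_trans)
      qed
      moreover have "q v0 = 0" using v0 by (simp add: q_def)
      moreover have "torus_form n V q z a = torus_form n V p z a" for a
      proof -
        have "torus_form n V q z a = torus_form n V p z a - t * torus_form n V \<mu> z a"
          by (simp add: torus_form_def q_def sum_subtractf sum_distrib_left left_diff_distrib mult_ac)
        then show ?thesis using zero by simp
      qed
      ultimately show ?thesis using drop[of v0 q] v0 by blast
    qed
  qed
qed

lemma torus_weights_reindex:
  fixes z :: "'v \<Rightarrow> nat \<Rightarrow> complex"
  assumes h: "bij_betw h I S" and w: "torus_weights n S p z"
  shows "torus_weights n I (p \<circ> h) (z \<circ> h)"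
    and "torus_form n I (p \<circ> h) (z \<circ> h) a = torus_form n S p z a"
proof -
  have "finite I" using h w bij_betw_finite by (auto simp: torus_weights_def)
  moreover have "sum (p \<circ> h) I = sum p S"
    using sum.reindex_bij_betw[OF h, of p] by simp
  ultimately show "torus_weights n I (p \<circ> h) (z \<circ> h)"
    using w bij_betwE[OF h] by (auto simp: torus_weights_def)
  show "torus_form n I (p \<circ> h) (z \<circ> h) a = torus_form n S p z a"
    using sum.reindex_bij_betw[OF h, of "\<lambda>v. p v * (cmod (\<Sum>j<n. a j * z v j))\<^sup>2"]
    by (simp add: torus_form_def)
qed

lemma torus_form_few_atoms:
  fixes z :: "'v \<Rightarrow> nat \<Rightarrow> complex"
  assumes "torus_weights n V p z" "n \<ge> 1"
  shows "\<exists>l P Z. l \<le> n\<^sup>2 \<and> (\<forall>i<l. 0 < P i) \<and> torus_weights n {..<l::nat} P Z \<and>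
           (\<forall>a. torus_form n {..<l} P Z a = torus_form n V p z a)"
proof -
  obtain S p' where S: "card S \<le> n\<^sup>2" "\<forall>v\<in>S. 0 < p' v" "torus_weights n S p' z"
    "\<forall>a. torus_form n S p' z a = torus_form n V p z a"
    using torus_form_caratheodory[OF assms] by metis
  have "finite S" using S by (simp add: torus_weights_def)
  then obtain h where h: "bij_betw h {..<card S} S"
    using ex_bij_betw_nat_finite[of S] by (auto simp: atLeast0LessThan)
  show ?thesis
    using S torus_weights_reindex[OF h S(3)] bij_betwE[OF h]
    by (intro exI[of _ "card S"] exI[of _ "p' \<circ> h"] exI[of _ "z \<circ> h"]) auto
qed

text \<open>
  A fixed number of atoms makes the parameter space independent of the form. Missing atoms get
  weight 0, and every irrelevant entry is set to 1 to stay on the unit circle, so that the parameters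
  of all forms lie in one compact product.
\<close>

lemma torus_form_padded:
  fixes z :: "'v \<Rightarrow> nat \<Rightarrow> complex"
  assumes "torus_weights n V p z" "n \<ge> 1"
  shows "\<exists>P Z. torus_weights n {..<n\<^sup>2} P Z \<and> (\<forall>i. P i \<in> {0..1}) \<and> (\<forall>i j. Z i j \<in> sphere 0 1) \<and>
           (\<forall>a. torus_form n {..<n\<^sup>2} P Z a = torus_form n V p z a)"
proof -
  obtain l P Z where l: "l \<le> n\<^sup>2" "\<forall>i<l. 0 < P i" "torus_weights n {..<l::nat} P Z"
    "\<forall>a. torus_form n {..<l} P Z a = torus_form n V p z a"
    using torus_form_few_atoms[OF assms] by metis
  define P' where "P' = (\<lambda>i. if i < l then P i else 0)"
  define Z' where "Z' = (\<lambda>i j. if i < l \<and> j < n then Z i j else 1)"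
  have sub: "{..<l} \<subseteq> {..<n\<^sup>2}" using l(1) by auto
  have "sum P' {..<n\<^sup>2} = sum P {..<l}"
    by (rule sum.mono_neutral_cong_right) (use sub in \<open>auto simp: P'_def\<close>)
  also have P1: "\<dots> = 1" using l(3) by (simp add: torus_weights_def)
  finally have "sum P' {..<n\<^sup>2} = 1" .
  moreover have "torus_form n {..<n\<^sup>2} P' Z' a = torus_form n {..<l} P Z a" for a
    unfolding torus_form_def
    by (rule sum.mono_neutral_cong_right) (use sub in \<open>auto simp: P'_def Z'_def\<close>)
  moreover have "P' i \<in> {0..1}" for i
  proof (cases "i < l")
    case True
    have "P i \<le> sum P {..<l}"
      by (rule member_le_sum) (use True l in \<open>auto simp: torus_weights_def\<close>)
    then show ?thesis using True l P1 by (auto simp: P'_def less_imp_le)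
  qed (simp add: P'_def)
  moreover have "Z' i j \<in> sphere 0 1" for i j
    using l(3) by (auto simp: Z'_def torus_weights_def)
  ultimately show ?thesis
    using l by (intro exI[of _ P'] exI[of _ Z']) (auto simp: torus_weights_def P'_def less_imp_le)
qed

lemma compact_fun_UNIV:
  fixes K :: "'b::topological_space set"
  assumes "compact K"
  shows "compact {f :: 'a \<Rightarrow> 'b. \<forall>x. f x \<in> K}"
proof -
  have "{f :: 'a \<Rightarrow> 'b. \<forall>x. f x \<in> K} = PiE UNIV (\<lambda>_. K)" by auto
  moreover have "compactin (product_topology (\<lambda>_. euclidean) UNIV) (PiE (UNIV::'a set) (\<lambda>_. K))"
    unfolding compactin_PiE using assms by simp
  ultimately show ?thesis by (simp add: euclidean_product_topology)
qed

text \<open>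
  Compactness of the hull, in the form in which it is used: a subsequence of the parameters
  converges. The limiting weights may vanish, and a final reduction removes such atoms.
\<close>

lemma torus_form_limit:
  fixes z :: "nat \<Rightarrow> 'v \<Rightarrow> nat \<Rightarrow> complex"
  assumes n: "n \<ge> 1" and w: "\<And>k. torus_weights n (V k) (p k) (z k)"
  shows "\<exists>l P Z r. l \<le> n\<^sup>2 \<and> (\<forall>i<l. 0 < P i) \<and> torus_weights n {..<l::nat} P Z \<and> strict_mono r \<and>
    (\<forall>a. (\<lambda>k. torus_form n (V (r k)) (p (r k)) (z (r k)) a) \<longlonglongrightarrow> torus_form n {..<l} P Z a)"
proof -
  obtain P Z where PZ: "\<And>k. torus_weights n {..<n\<^sup>2} (P k) (Z k)" "\<And>k i. P k i \<in> {0..1}"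
      "\<And>k i j. Z k i j \<in> sphere 0 1"
      "\<And>k a. torus_form n {..<n\<^sup>2} (P k) (Z k) a = torus_form n (V k) (p k) (z k) a"
    using torus_form_padded[OF w n] by metis
  define K where "K = {f :: nat \<Rightarrow> real \<times> (nat \<Rightarrow> complex). \<forall>i. f i \<in> {0..1} \<times> {g. \<forall>j. g j \<in> sphere 0 1}}"
  have "compact K" unfolding K_def
    by (intro compact_fun_UNIV compact_Times) simp_all
  then have seqK: "seq_compact K" by (simp add: compact_eq_seq_compact_metric)
  have inK: "(\<lambda>i. (P k i, Z k i)) \<in> K" for k using PZ(2,3) by (simp add: K_def)
  obtain f r where f: "f \<in> K" "strict_mono r"
    and lim: "((\<lambda>k. (\<lambda>i. (P k i, Z k i))) \<circ> r) \<longlonglongrightarrow> f"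
    using seq_compactE[OF seqK, of "\<lambda>k. (\<lambda>i. (P k i, Z k i))", OF allI[OF inK]] by blast
  have coord: "(\<lambda>k. g k i) \<longlonglongrightarrow> h i" if "g \<longlonglongrightarrow> h" for g :: "nat \<Rightarrow> 'c \<Rightarrow> 'd::topological_space" and h i
    using continuous_on_tendsto_compose[OF continuous_on_product_coordinates that, of i] by simp
  have lim1: "(\<lambda>k. (P (r k) i, Z (r k) i)) \<longlonglongrightarrow> f i" for i
    using coord[OF lim, of i] by (simp add: o_def)
  have limP: "(\<lambda>k. P (r k) i) \<longlonglongrightarrow> fst (f i)" for i
    using tendsto_fst[OF lim1[of i]] by simp
  have limZ: "(\<lambda>k. Z (r k) i j) \<longlonglongrightarrow> snd (f i) j" for i j
    using coord[OF tendsto_snd[OF lim1[of i]], of j] by simp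
  let ?P = "\<lambda>i. fst (f i)" and ?Z = "\<lambda>i. snd (f i)"
  have "(\<lambda>k. \<Sum>i<n\<^sup>2. P (r k) i) \<longlonglongrightarrow> (\<Sum>i<n\<^sup>2. ?P i)" by (intro tendsto_sum limP)
  moreover have "(\<Sum>i<n\<^sup>2. P (r k) i) = 1" for k using PZ(1)[of "r k"] by (simp add: torus_weights_def)
  ultimately have "(\<Sum>i<n\<^sup>2. ?P i) = 1" by (simp add: LIMSEQ_const_iff)
  moreover have "0 \<le> ?P i" "cmod (?Z i j) = 1" for i j
    using f(1) by (auto simp: K_def mem_Times_iff)
  ultimately have "torus_weights n {..<n\<^sup>2} ?P ?Z" by (auto simp: torus_weights_def)
  from torus_form_few_atoms[OF this n] obtain l P' Z' where l: "l \<le> n\<^sup>2" "\<forall>i<l. 0 < P' i"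
      "torus_weights n {..<l::nat} P' Z'"
      "\<And>a. torus_form n {..<l} P' Z' a = torus_form n {..<n\<^sup>2} ?P ?Z a"
    by metis
  have "(\<lambda>k. torus_form n {..<n\<^sup>2} (P (r k)) (Z (r k)) a) \<longlonglongrightarrow> torus_form n {..<n\<^sup>2} ?P ?Z a" for a
    unfolding torus_form_def by (intro tendsto_intros limP limZ)
  then have "(\<lambda>k. torus_form n (V (r k)) (p (r k)) (z (r k)) a) \<longlonglongrightarrow> torus_form n {..<l} P' Z' a" for a
    by (simp add: PZ(4) l(4))
  then show ?thesis using l f(2)
    by (intro exI[of _ l] exI[of _ P'] exI[of _ Z'] exI[of _ r]) auto
qed

section \<open>Vectors of variable dimension and least squares\<close>

text \<open>
  Vectors of dimension \<open>N\<close> are functions of which only the first \<open>N\<close> values count; this allows \<open>N\<close>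
  to vary within a statement. The form is linear in its first argument.
\<close>

definition cdot :: "nat \<Rightarrow> (nat \<Rightarrow> complex) \<Rightarrow> (nat \<Rightarrow> complex) \<Rightarrow> complex" where
  "cdot N u w = (\<Sum>k<N. u k * cnj (w k))"

definition nrm :: "nat \<Rightarrow> (nat \<Rightarrow> complex) \<Rightarrow> real" where
  "nrm N u = L2_set (\<lambda>k. cmod (u k)) {..<N}"

lemma nrm_nonneg [simp]: "0 \<le> nrm N u" by (simp add: nrm_def)

lemma nrm_sq: "(nrm N u)\<^sup>2 = (\<Sum>k<N. (cmod (u k))\<^sup>2)"
  by (simp add: nrm_def L2_set_def sum_nonneg)

lemma cdot_self: "cdot N u u = of_real ((nrm N u)\<^sup>2)"
  unfolding cdot_def nrm_sq complex_norm_square[symmetric] by simp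

lemma cdot_commute: "cdot N u w = cnj (cdot N w u)"
  by (simp add: cdot_def mult.commute)

lemma cdot_add_left: "cdot N (\<lambda>k. u k + v k) w = cdot N u w + cdot N v w"
  by (simp add: cdot_def algebra_simps sum.distrib)

lemma cdot_diff_left: "cdot N (\<lambda>k. u k - v k) w = cdot N u w - cdot N v w"
  by (simp add: cdot_def algebra_simps sum_subtractf)

lemma cdot_scale_left: "cdot N (\<lambda>k. c * u k) w = c * cdot N u w"
  by (simp add: cdot_def algebra_simps sum_distrib_left)

lemma cdot_add_right: "cdot N w (\<lambda>k. u k + v k) = cdot N w u + cdot N w v"
  by (simp add: cdot_def algebra_simps sum.distrib)

lemma cdot_diff_right: "cdot N w (\<lambda>k. u k - v k) = cdot N w u - cdot N w v"
  by (simp add: cdot_def algebra_simps sum_subtractf)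

lemma cdot_scale_right: "cdot N w (\<lambda>k. c * u k) = cnj c * cdot N w u"
  by (simp add: cdot_def algebra_simps sum_distrib_left)

lemma cdot_sum_left: "cdot N (\<lambda>k. \<Sum>j\<in>J. f j k) w = (\<Sum>j\<in>J. cdot N (f j) w)"
  unfolding cdot_def sum_distrib_right by (rule sum.swap)

lemma cdot_sum_right: "cdot N w (\<lambda>k. \<Sum>j\<in>J. f j k) = (\<Sum>j\<in>J. cdot N w (f j))"
  unfolding cdot_def cnj_sum sum_distrib_left by (rule sum.swap)

lemma cdot_cauchy_schwarz: "cmod (cdot N u w) \<le> nrm N u * nrm N w"
proof -
  have "cmod (cdot N u w) \<le> (\<Sum>k<N. \<bar>cmod (u k)\<bar> * \<bar>cmod (w k)\<bar>)"
    unfolding cdot_def by (rule order_trans[OF norm_sum]) (simp add: norm_mult)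
  also have "\<dots> \<le> nrm N u * nrm N w" unfolding nrm_def by (rule L2_set_mult_ineq)
  finally show ?thesis .
qed

lemma nrm_triangle: "nrm N (\<lambda>k. u k + w k) \<le> nrm N u + nrm N w"
proof -
  have "nrm N (\<lambda>k. u k + w k) \<le> L2_set (\<lambda>k. cmod (u k) + cmod (w k)) {..<N}"
    unfolding nrm_def by (rule L2_set_mono) (auto simp: norm_triangle_ineq)
  also have "\<dots> \<le> nrm N u + nrm N w" unfolding nrm_def by (rule L2_set_triangle_ineq)
  finally show ?thesis .
qed

lemma nrm_scale: "nrm N (\<lambda>k. c * u k) = cmod c * nrm N u"
  unfolding nrm_def by (simp add: norm_mult L2_set_right_distrib)

lemma nrm_eq_0_iff: "nrm N u = 0 \<longleftrightarrow> (\<forall>k<N. u k = 0)"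
  by (auto simp: nrm_def L2_set_eq_0_iff)

lemma nrm_cong: "(\<And>k. k < N \<Longrightarrow> u k = w k) \<Longrightarrow> nrm N u = nrm N w"
  unfolding nrm_def by (rule L2_set_cong) auto

text \<open>
  Least squares by Gram-Schmidt: the coefficients of a best approximation can be chosen as linear
  functionals \<open>\<beta>\<^sub>j\<close> of the approximated vector \<open>v\<close>. For a new column \<open>y\<^sub>n\<close> only its component \<open>w\<close>
  orthogonal to the earlier ones matters, and the new functional is \<open>\<langle>v, w\<rangle> / \<parallel>w\<parallel>\<^sup>2\<close>.
\<close>

lemma normal_equations_solvable:
  fixes y :: "nat \<Rightarrow> nat \<Rightarrow> complex"
  shows "\<exists>\<beta>. \<forall>v. \<forall>k<n. cdot l (\<lambda>i. v i - (\<Sum>j<n. (\<Sum>i'<l. \<beta> j i' * v i') * y j i)) (y k) = 0"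
proof (induction n)
  case 0
  then show ?case by simp
next
  case (Suc n)
  then obtain \<beta> where \<beta>: "\<And>v k. k < n \<Longrightarrow>
      cdot l (\<lambda>i. v i - (\<Sum>j<n. (\<Sum>i'<l. \<beta> j i' * v i') * y j i)) (y k) = 0" by blast
  define b where "b = (\<lambda>j v. \<Sum>i'<l. \<beta> j i' * v i')"
  define P where "P v = (\<lambda>i. \<Sum>j<n. b j v * y j i)" for v
  define w where "w = (\<lambda>i. y n i - P (y n) i)"
  have orth: "cdot l (\<lambda>i. v i - P v i) (y k) = 0" if "k < n" for v k
    using \<beta>[of k v] that by (simp add: P_def b_def)
  have orth_span: "cdot l (\<lambda>i. v i - P v i) (P u) = 0" for v u
    unfolding P_def[of u] cdot_sum_right cdot_scale_right using orth by simp
  have w_orth: "cdot l w (y k) = 0" if "k < n" for k using orth[of k "y n"] that by (simp add: w_def)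
  have w_span: "cdot l w (P u) = 0" for u using orth_span by (simp add: w_def)
  have span_w: "cdot l (P u) w = 0" for u using w_span cdot_commute[of l "P u" w] by simp
  have yn: "y n = (\<lambda>i. w i + P (y n) i)" by (simp add: w_def)
  define N where "N = complex_of_real ((nrm l w)\<^sup>2)"
  \<comment> \<open>if the new column depends on the earlier ones, its coefficient is taken to be zero\<close>
  define c where "c = (\<lambda>i. if nrm l w = 0 then 0 else cnj (w i) / N)"
  define \<gamma> where "\<gamma> = (\<lambda>v. \<Sum>i'<l. c i' * v i')"
  have \<gamma>: "\<gamma> v * N = cdot l v w" for v
  proof (cases "nrm l w = 0")
    case True
    then have "cdot l v w = 0" using cdot_cauchy_schwarz[of l v w] by simp
    then show ?thesis by (simp add: \<gamma>_def c_def True)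
  next
    case False
    then show ?thesis
      by (simp add: \<gamma>_def c_def cdot_def N_def sum_divide_distrib[symmetric] mult.commute)
  qed
  define \<beta>' where "\<beta>' = (\<lambda>j i. if j = n then c i else \<beta> j i - b j (y n) * c i)"
  have b': "(\<Sum>i'<l. \<beta>' j i' * v i') = (if j = n then \<gamma> v else b j v - b j (y n) * \<gamma> v)" for j v
  proof -
    have "(\<Sum>i'<l. (\<beta> j i' - B * c i') * v i') = b j v - B * \<gamma> v" for B
      by (simp add: b_def \<gamma>_def left_diff_distrib sum_subtractf sum_distrib_left mult.assoc)
    then show ?thesis by (simp add: \<beta>'_def \<gamma>_def)
  qed
  have res: "v i - (\<Sum>j<Suc n. (\<Sum>i'<l. \<beta>' j i' * v i') * y j i) = (v i - P v i) - \<gamma> v * w i" for v i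
  proof -
    have "(\<Sum>j<Suc n. (\<Sum>i'<l. \<beta>' j i' * v i') * y j i)
        = (\<Sum>j<n. (b j v - b j (y n) * \<gamma> v) * y j i) + \<gamma> v * y n i"
      unfolding b' by simp
    also have "(\<Sum>j<n. (b j v - b j (y n) * \<gamma> v) * y j i) = P v i - \<gamma> v * P (y n) i"
      by (simp add: P_def left_diff_distrib right_diff_distrib sum_subtractf sum_distrib_left mult_ac)
    finally show ?thesis by (simp add: w_def right_diff_distrib)
  qed
  have "cdot l (\<lambda>i. (v i - P v i) - \<gamma> v * w i) (y k) = 0" if "k < Suc n" for v k
  proof (cases "k = n")
    case False
    then show ?thesis using that orth w_orth
      by (simp add: cdot_diff_left[of l "\<lambda>i. v i - P v i"] cdot_scale_left)
  next
    case True
    have "cdot l (\<lambda>i. (v i - P v i) - \<gamma> v * w i) w = cdot l v w - \<gamma> v * cdot l w w"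
      using span_w by (simp add: cdot_diff_left cdot_scale_left)
    also have "\<dots> = 0" using \<gamma>[of v] by (simp add: cdot_self N_def)
    finally have "cdot l (\<lambda>i. (v i - P v i) - \<gamma> v * w i) w = 0" .
    moreover have "cdot l (\<lambda>i. (v i - P v i) - \<gamma> v * w i) (P (y n)) = 0"
      using orth_span w_span by (simp add: cdot_diff_left[of l "\<lambda>i. v i - P v i"] cdot_scale_left)
    ultimately show ?thesis unfolding True by (subst yn) (simp add: cdot_add_right)
  qed
  then have "\<forall>v. \<forall>k<Suc n. cdot l (\<lambda>i. v i - (\<Sum>j<Suc n. (\<Sum>i'<l. \<beta>' j i' * v i') * y j i)) (y k) = 0"
    unfolding res by simp
  then show ?case by (rule exI[of _ \<beta>'])
qed

text \<open>
  The coefficient matrix \<open>\<beta>\<close> of the orthogonal projection onto the span of the columns: composing it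
  with the columns fixes every column and does not increase norms. It replaces the extension of an
  operator from a subspace by zero on the orthogonal complement.
\<close>

lemma contractive_generalized_inverse:
  fixes y :: "nat \<Rightarrow> nat \<Rightarrow> complex"
  shows "\<exists>\<beta>. (\<forall>k<n. \<forall>i<l. (\<Sum>j<n. (\<Sum>i'<l. \<beta> j i' * y k i') * y j i) = y k i) \<and>
             (\<forall>v. nrm l (\<lambda>i. \<Sum>j<n. (\<Sum>i'<l. \<beta> j i' * v i') * y j i) \<le> nrm l v)"
proof -
  obtain \<beta> where \<beta>: "\<And>v k. k < n \<Longrightarrow>
      cdot l (\<lambda>i. v i - (\<Sum>j<n. (\<Sum>i'<l. \<beta> j i' * v i') * y j i)) (y k) = 0"
    using normal_equations_solvable[of n l y] by blast
  define P where "P v = (\<lambda>i. \<Sum>j<n. (\<Sum>i'<l. \<beta> j i' * v i') * y j i)" for v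
  define R where "R = (\<lambda>v i. v i - P v i)"
  have orth: "cdot l (R v) (y k) = 0" if "k < n" for v k
    using \<beta>[of k v] that by (simp add: R_def P_def)
  have orth_span: "cdot l (R v) (P u) = 0" for v u
    unfolding P_def[of u] cdot_sum_right cdot_scale_right using orth by simp
  have "P (y k) i = y k i" if "k < n" "i < l" for k i
  proof -
    have "cdot l (R (y k)) (R (y k)) = cdot l (R (y k)) (y k) - cdot l (R (y k)) (P (y k))"
      unfolding cdot_diff_right[symmetric] by (simp add: R_def)
    also have "\<dots> = 0" using orth orth_span that by simp
    finally have "nrm l (R (y k)) = 0" by (simp add: cdot_self)
    then show ?thesis using that by (simp add: nrm_eq_0_iff R_def)
  qed
  moreover have "nrm l (P v) \<le> nrm l v" for v
  proof -
    have "cdot l (P v) (P v) = cdot l v (P v)"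
      using orth_span[of v v] cdot_diff_left[of l v "P v" "P v"] by (simp add: R_def)
    then have "(nrm l (P v))\<^sup>2 = cmod (cdot l v (P v))" by (metis cdot_self norm_of_real abs_power2)
    also have "\<dots> \<le> nrm l v * nrm l (P v)" by (rule cdot_cauchy_schwarz)
    finally have "nrm l (P v) * nrm l (P v) \<le> nrm l v * nrm l (P v)" by (simp add: power2_eq_square)
    then show ?thesis
      by (metis mult_le_cancel_right nrm_nonneg order_less_le)
  qed
  ultimately show ?thesis unfolding P_def by (intro exI[of _ \<beta>]) simp
qed

section \<open>Gaussian vectors\<close>

text \<open>
  The mean of the absolute real part over all rotations of a complex number recovers its modulus.
  The sinusoid equals \<open>r sin (\<theta> + \<psi>)\<close>, which changes sign once on the interval, at \<open>pi - \<psi>\<close>.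
\<close>

lemma nn_integral_abs_sinusoid:
  fixes x y :: real
  shows "(\<integral>\<^sup>+\<theta>. ennreal \<bar>cos \<theta> * x + sin \<theta> * y\<bar> * indicator {0..pi} \<theta> \<partial>lborel) = ennreal (2 * sqrt (x\<^sup>2 + y\<^sup>2))"
proof -
  have main: "(\<integral>\<^sup>+\<theta>. ennreal \<bar>cos \<theta> * x + sin \<theta> * y\<bar> * indicator {0..pi} \<theta> \<partial>lborel)
      = ennreal (2 * sqrt (x\<^sup>2 + y\<^sup>2))" if "0 \<le> x" for x y :: real
  proof (cases "x = 0 \<and> y = 0")
    case True
    then show ?thesis by simp
  next
    case False
    define r where "r = sqrt (x\<^sup>2 + y\<^sup>2)"
    have r: "r > 0" using False sum_power2_gt_zero_iff[of x y] unfolding r_def by auto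
    have r2: "r\<^sup>2 = x\<^sup>2 + y\<^sup>2" by (simp add: r_def)
    have "(y / r)\<^sup>2 + (x / r)\<^sup>2 = (x\<^sup>2 + y\<^sup>2) / r\<^sup>2"
      by (simp add: power_divide add_divide_distrib add.commute)
    then have "(y / r)\<^sup>2 + (x / r)\<^sup>2 = 1" using r by (simp add: r2[symmetric])
    moreover have "0 \<le> x / r" using that r by simp
    ultimately obtain \<psi> where \<psi>: "0 \<le> \<psi>" "\<psi> \<le> pi" "y / r = cos \<psi>" "x / r = sin \<psi>"
      using sincos_total_pi[of "x / r" "y / r"] by auto
    have eq: "cos \<theta> * x + sin \<theta> * y = r * sin (\<theta> + \<psi>)" for \<theta>
    proof -
      have "x = r * sin \<psi>" "y = r * cos \<psi>" using \<psi>(3,4) r by (simp_all add: field_simps)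
      then show ?thesis by (simp add: sin_add algebra_simps)
    qed
    have "((\<lambda>\<theta>. r * sin (\<theta> + \<psi>)) has_integral (- r * cos ((pi - \<psi>) + \<psi>) - (- r * cos (0 + \<psi>)))) {0..pi - \<psi>}"
      by (rule fundamental_theorem_of_calculus)
         (use \<psi> in \<open>auto intro!: derivative_eq_intros simp: has_real_derivative_iff_has_vector_derivative[symmetric]\<close>)
    moreover have "\<bar>r * sin (\<theta> + \<psi>)\<bar> = r * sin (\<theta> + \<psi>)" if "\<theta> \<in> {0..pi - \<psi>}" for \<theta>
      using that \<psi> r by (intro abs_of_nonneg mult_nonneg_nonneg sin_ge_zero) auto
    ultimately have 1: "((\<lambda>\<theta>. \<bar>r * sin (\<theta> + \<psi>)\<bar>) has_integral (r + r * cos \<psi>)) {0..pi - \<psi>}"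
      by (subst has_integral_cong[where g = "\<lambda>\<theta>. r * sin (\<theta> + \<psi>)"]) auto
    have "((\<lambda>\<theta>. - (r * sin (\<theta> + \<psi>))) has_integral (r * cos (pi + \<psi>) - r * cos ((pi - \<psi>) + \<psi>))) {pi - \<psi>..pi}"
      by (rule fundamental_theorem_of_calculus)
         (use \<psi> in \<open>auto intro!: derivative_eq_intros simp: has_real_derivative_iff_has_vector_derivative[symmetric]\<close>)
    moreover have "\<bar>r * sin (\<theta> + \<psi>)\<bar> = - (r * sin (\<theta> + \<psi>))" if "\<theta> \<in> {pi - \<psi>..pi}" for \<theta>
    proof -
      have "0 \<le> sin (\<theta> + \<psi> - pi)" using that \<psi> by (intro sin_ge_zero) auto
      then have "sin (\<theta> + \<psi>) \<le> 0" by (simp add: sin_diff)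
      then show ?thesis using r by (simp add: abs_mult abs_of_nonpos)
    qed
    ultimately have 2: "((\<lambda>\<theta>. \<bar>r * sin (\<theta> + \<psi>)\<bar>) has_integral (r - r * cos \<psi>)) {pi - \<psi>..pi}"
      by (subst has_integral_cong[where g = "\<lambda>\<theta>. - (r * sin (\<theta> + \<psi>))"]) (auto simp: algebra_simps)
    have "((\<lambda>\<theta>. \<bar>r * sin (\<theta> + \<psi>)\<bar>) has_integral (r + r * cos \<psi> + (r - r * cos \<psi>))) {0..pi}"
      by (rule has_integral_combine[OF _ _ 1 2]) (use \<psi> in auto)
    then have "((\<lambda>\<theta>. \<bar>r * sin (\<theta> + \<psi>)\<bar>) has_integral (2 * r)) {0..pi}" by simp
    from nn_integral_has_integral_lebesgue[OF _ this]
    have "(\<integral>\<^sup>+\<theta>. ennreal (indicator {0..pi} \<theta> * \<bar>r * sin (\<theta> + \<psi>)\<bar>) \<partial>lborel) = ennreal (2 * r)"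
      by simp
    then show ?thesis unfolding eq
      by (simp add: r_def ennreal_mult' ennreal_indicator mult.commute)
  qed
  show ?thesis
  proof (cases "0 \<le> x")
    case True
    then show ?thesis by (rule main)
  next
    case False
    have "\<bar>cos \<theta> * x + sin \<theta> * y\<bar> = \<bar>cos \<theta> * (-x) + sin \<theta> * (-y)\<bar>" for \<theta> by simp
    then show ?thesis using main[of "-x" "-y"] False by simp
  qed
qed

definition std_normal :: "real measure" where
  "std_normal = density lborel std_normal_density"

text \<open>
  The flag distinguishes real parts (\<^term>\<open>True\<close>) from imaginary parts (\<^term>\<open>False\<close>).
\<close>

definition gauss_index :: "nat \<Rightarrow> (nat \<times> bool) set" where
  "gauss_index N = {..<N} \<times> UNIV"

definition gauss :: "nat \<Rightarrow> (nat \<times> bool \<Rightarrow> real) measure" where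
  "gauss N = PiM (gauss_index N) (\<lambda>_. std_normal)"

lemma prob_space_std_normal: "prob_space std_normal"
  unfolding std_normal_def by (rule prob_space_normal_density) simp

lemma sets_std_normal [measurable_cong, simp]: "sets std_normal = sets borel"
  by (simp add: std_normal_def)

lemma space_std_normal [simp]: "space std_normal = UNIV"
  by (simp add: std_normal_def)

lemma finite_gauss_index [simp]: "finite (gauss_index N)"
  by (simp add: gauss_index_def)

lemma prob_space_gauss: "prob_space (gauss N)"
  unfolding gauss_def by (intro prob_space_PiM prob_space_std_normal)

lemma measurable_gauss_coord [measurable]:
  "i \<in> gauss_index N \<Longrightarrow> (\<lambda>\<omega>. \<omega> i) \<in> borel_measurable (gauss N)"
  unfolding gauss_def by measurable

lemma distr_gauss_coord:
  assumes "i \<in> gauss_index N"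
  shows "distr (gauss N) borel (\<lambda>\<omega>. \<omega> i) = std_normal"
proof -
  have "distr (gauss N) borel (\<lambda>\<omega>. \<omega> i) = distr (gauss N) std_normal (\<lambda>\<omega>. \<omega> i)"
    by (rule distr_cong) simp_all
  then show ?thesis
    using distr_PiM_component[of "gauss_index N" "\<lambda>_. std_normal" i] assms prob_space_std_normal
    by (simp add: gauss_def)
qed

lemma gauss_coord_distributed:
  assumes "i \<in> gauss_index N"
  shows "distributed (gauss N) lborel (\<lambda>\<omega>. \<omega> i) std_normal_density"
proof -
  have "distr (gauss N) lborel (\<lambda>\<omega>. \<omega> i) = distr (gauss N) borel (\<lambda>\<omega>. \<omega> i)"
    by (rule distr_cong) simp_all
  then show ?thesis using distr_gauss_coord[OF assms] assms
    by (simp add: distributed_def std_normal_def)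
qed

lemma gauss_coord_indep:
  assumes "J \<subseteq> gauss_index N"
  shows "prob_space.indep_vars (gauss N) (\<lambda>_. borel) (\<lambda>i \<omega>. \<omega> i) J"
proof -
  interpret prob_space "gauss N" by (rule prob_space_gauss)
  have "indep_vars (\<lambda>_. borel) (\<lambda>i \<omega>. \<omega> i) (gauss_index N)"
  proof (cases "gauss_index N = {}")
    case True
    then show ?thesis by (simp add: indep_vars_def indep_sets_def)
  next
    case False
    have "distr (gauss N) (\<Pi>\<^sub>M i\<in>gauss_index N. borel) (\<lambda>x. \<lambda>i\<in>gauss_index N. x i)
        = distr (gauss N) (gauss N) (\<lambda>x. x)"
      by (rule distr_cong) (auto simp: gauss_def space_PiM intro!: sets_PiM_cong)
    also have "\<dots> = gauss N" by (rule distr_id)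
    also have "\<dots> = (\<Pi>\<^sub>M i\<in>gauss_index N. distr (gauss N) borel (\<lambda>\<omega>. \<omega> i))"
      unfolding gauss_def by (rule PiM_cong) (simp_all add: distr_gauss_coord flip: gauss_def)
    finally show ?thesis
      by (subst indep_vars_iff_distr_eq_PiM'[OF False]) auto
  qed
  then show ?thesis using assms by (rule indep_vars_subset)
qed

lemma gauss_linear_distributed:
  fixes \<alpha> :: "nat \<times> bool \<Rightarrow> real"
  assumes "(\<Sum>i\<in>gauss_index N. (\<alpha> i)\<^sup>2) \<noteq> 0"
  shows "distributed (gauss N) lborel (\<lambda>\<omega>. \<Sum>i\<in>gauss_index N. \<alpha> i * \<omega> i)
           (normal_density 0 (sqrt (\<Sum>i\<in>gauss_index N. (\<alpha> i)\<^sup>2)))"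
proof -
  interpret prob_space "gauss N" by (rule prob_space_gauss)
  define J where "J = {i \<in> gauss_index N. \<alpha> i \<noteq> 0}"
  have J: "J \<subseteq> gauss_index N" "finite J" by (auto simp: J_def)
  have "J \<noteq> {}"
  proof
    assume "J = {}"
    then have "(\<Sum>i\<in>gauss_index N. (\<alpha> i)\<^sup>2) = 0" by (intro sum.neutral) (auto simp: J_def)
    with assms show False by simp
  qed
  have ind: "indep_vars (\<lambda>_. borel) (\<lambda>i \<omega>. \<alpha> i * \<omega> i) J"
    using indep_vars_compose[OF gauss_coord_indep[OF J(1)], of "\<lambda>i x. \<alpha> i * x" "\<lambda>_. borel"]
    by (simp add: o_def)
  have dist: "distributed (gauss N) lborel (\<lambda>\<omega>. \<alpha> i * \<omega> i) (normal_density 0 \<bar>\<alpha> i\<bar>)" if "i \<in> J" for i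
    using normal_density_affine[OF gauss_coord_distributed[of i N], of "\<alpha> i" 0] that by (simp add: J_def)
  have "distributed (gauss N) lborel (\<lambda>\<omega>. \<Sum>i\<in>J. \<alpha> i * \<omega> i)
      (normal_density (\<Sum>i\<in>J. 0) (sqrt (\<Sum>i\<in>J. \<bar>\<alpha> i\<bar>\<^sup>2)))"
    by (rule sum_indep_normal[OF J(2) \<open>J \<noteq> {}\<close> ind _ dist]) (auto simp: J_def)
  moreover have "(\<Sum>i\<in>J. \<alpha> i * \<omega> i) = (\<Sum>i\<in>gauss_index N. \<alpha> i * \<omega> i)" for \<omega> :: "nat \<times> bool \<Rightarrow> real"
    by (rule sum.mono_neutral_left) (auto simp: J_def)
  moreover have "(\<Sum>i\<in>J. \<bar>\<alpha> i\<bar>\<^sup>2) = (\<Sum>i\<in>gauss_index N. (\<alpha> i)\<^sup>2)"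
    by (subst power2_abs, rule sum.mono_neutral_left) (auto simp: J_def)
  ultimately show ?thesis by simp
qed

text \<open>
  A linear combination of independent standard normal variables is normal, so its moments depend
  on \<open>\<Sum> \<alpha>\<^sub>i\<^sup>2\<close> only.
\<close>

lemma gauss_linear_moments:
  fixes \<alpha> :: "nat \<times> bool \<Rightarrow> real" and N :: nat
  defines "L \<equiv> \<lambda>\<omega>. \<Sum>i\<in>gauss_index N. \<alpha> i * \<omega> i"
  shows "has_bochner_integral (gauss N) (\<lambda>\<omega>. \<bar>L \<omega>\<bar>) (sqrt (2 / pi) * sqrt (\<Sum>i\<in>gauss_index N. (\<alpha> i)\<^sup>2))"
    and "has_bochner_integral (gauss N) (\<lambda>\<omega>. (L \<omega>)\<^sup>2) (\<Sum>i\<in>gauss_index N. (\<alpha> i)\<^sup>2)"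
proof -
  interpret prob_space "gauss N" by (rule prob_space_gauss)
  define S where "S = (\<Sum>i\<in>gauss_index N. (\<alpha> i)\<^sup>2)"
  have "has_bochner_integral (gauss N) (\<lambda>\<omega>. \<bar>L \<omega>\<bar>) (sqrt (2 / pi) * sqrt S) \<and>
        has_bochner_integral (gauss N) (\<lambda>\<omega>. (L \<omega>)\<^sup>2) S"
  proof (cases "S = 0")
    case True
    then have "\<alpha> i = 0" if "i \<in> gauss_index N" for i
      using that by (simp add: S_def sum_nonneg_eq_0_iff)
    then have "L \<omega> = 0" for \<omega> by (simp add: L_def)
    then show ?thesis using True by (simp add: has_bochner_integral_zero)
  next
    case False
    then have S: "S > 0" unfolding S_def by (simp add: sum_nonneg less_le)
    have D: "distributed (gauss N) lborel L (normal_density 0 (sqrt S))"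
      using gauss_linear_distributed[of \<alpha> N] False by (simp add: L_def S_def)
    have "has_bochner_integral lborel (\<lambda>x. normal_density 0 (sqrt S) x * \<bar>x\<bar>) (sqrt (2 / pi) * sqrt S)"
      using normal_moment_abs_odd[of "sqrt S" 0 0] S by (simp add: mult.commute)
    moreover have "has_bochner_integral lborel (\<lambda>x. normal_density 0 (sqrt S) x * x\<^sup>2) S"
      using normal_moment_even[of "sqrt S" 0 1] S by (simp add: fact_numeral)
    ultimately show ?thesis
      using distributed_integral[OF D, of abs] distributed_integrable[OF D, of abs]
        distributed_integral[OF D, of "\<lambda>x. x\<^sup>2"] distributed_integrable[OF D, of "\<lambda>x. x\<^sup>2"]
      by (simp add: has_bochner_integral_iff)
  qed
  then show "has_bochner_integral (gauss N) (\<lambda>\<omega>. \<bar>L \<omega>\<bar>) (sqrt (2 / pi) * sqrt (\<Sum>i\<in>gauss_index N. (\<alpha> i)\<^sup>2))"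
    and "has_bochner_integral (gauss N) (\<lambda>\<omega>. (L \<omega>)\<^sup>2) (\<Sum>i\<in>gauss_index N. (\<alpha> i)\<^sup>2)"
    by (simp_all add: S_def)
qed

text \<open>
  The factor \<open>1 / sqrt 2\<close> normalises each coordinate to \<open>E \<bar>g\<^sub>k\<bar>\<^sup>2 = 1\<close>.
\<close>

definition gvec :: "(nat \<times> bool \<Rightarrow> real) \<Rightarrow> nat \<Rightarrow> complex" where
  "gvec \<omega> k = Complex (\<omega> (k, True) / sqrt 2) (\<omega> (k, False) / sqrt 2)"

text \<open>
  The first absolute moment of a standard complex Gaussian variable; its reciprocal is
  \<^term>\<open>sqrt kGC\<close>.
\<close>

definition kappa :: real where
  "kappa = sqrt pi / 2"

lemma sum_gauss_index: "(\<Sum>i\<in>gauss_index N. f i) = (\<Sum>k<N. f (k, True) + f (k, False))"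
proof -
  have "(\<Sum>i\<in>gauss_index N. f i) = (\<Sum>k<N. \<Sum>b\<in>UNIV. f (k, b))"
    unfolding gauss_index_def by (simp add: sum.cartesian_product)
  then show ?thesis by (simp add: UNIV_bool add.commute)
qed

text \<open>
  The coefficients of \<open>Re (exp (-i \<theta>) \<langle>g, \<xi>\<rangle>)\<close> as a real linear form in the underlying normal
  variables.
\<close>

definition rot_coeff :: "real \<Rightarrow> (nat \<Rightarrow> complex) \<Rightarrow> nat \<times> bool \<Rightarrow> real" where
  "rot_coeff \<theta> \<xi> i = (if snd i then cos \<theta> * Re (\<xi> (fst i)) - sin \<theta> * Im (\<xi> (fst i))
                      else cos \<theta> * Im (\<xi> (fst i)) + sin \<theta> * Re (\<xi> (fst i))) / sqrt 2"

lemma cdot_gvec_rotated: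
  "cos \<theta> * Re (cdot N (gvec \<omega>) \<xi>) + sin \<theta> * Im (cdot N (gvec \<omega>) \<xi>) = (\<Sum>i\<in>gauss_index N. rot_coeff \<theta> \<xi> i * \<omega> i)"
  unfolding cdot_def sum_gauss_index Re_sum Im_sum sum_distrib_left sum.distrib[symmetric]
  by (rule sum.cong) (auto simp: rot_coeff_def gvec_def field_simps)

lemma sum_rot_coeff_sq: "(\<Sum>i\<in>gauss_index N. (rot_coeff \<theta> \<xi> i)\<^sup>2) = (nrm N \<xi>)\<^sup>2 / 2"
proof -
  have "(c * p - s * q)\<^sup>2 + (c * q + s * p)\<^sup>2 = p\<^sup>2 + q\<^sup>2" if "s\<^sup>2 + c\<^sup>2 = 1" for c s p q :: real
  proof -
    have "(c * p - s * q)\<^sup>2 + (c * q + s * p)\<^sup>2 = (s\<^sup>2 + c\<^sup>2) * (p\<^sup>2 + q\<^sup>2)"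
      by (simp add: power2_eq_square algebra_simps)
    then show ?thesis using that by simp
  qed
  then show ?thesis
    unfolding sum_gauss_index nrm_sq sum_divide_distrib
    by (intro sum.cong) (simp_all add: rot_coeff_def power_divide cmod_power2 flip: add_divide_distrib)
qed

lemma nrm_gvec_sq: "(nrm N (gvec \<omega>))\<^sup>2 = (\<Sum>i\<in>gauss_index N. (\<omega> i)\<^sup>2) / 2"
  unfolding nrm_sq sum_gauss_index sum_divide_distrib
  by (intro sum.cong) (simp_all add: gvec_def cmod_power2 power_divide add_divide_distrib)

lemma gauss_index_iff [simp]: "(k, b) \<in> gauss_index N \<longleftrightarrow> k < N"
  by (simp add: gauss_index_def)

lemma measurable_cdot_gvec [measurable]: 
  "(\<lambda>\<omega>. Re (cdot N (gvec \<omega>) \<xi>)) \<in> borel_measurable (gauss N)"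
  "(\<lambda>\<omega>. Im (cdot N (gvec \<omega>) \<xi>)) \<in> borel_measurable (gauss N)"
  using cdot_gvec_rotated[of 0 N _ \<xi>] cdot_gvec_rotated[of "pi/2" N _ \<xi>] by simp_all

text \<open>
  Averaging over the angle reduces the modulus of \<open>\<langle>g, \<xi>\<rangle>\<close> to the absolute values of real linear
  combinations, whose expectation is the same for every angle. This avoids the joint distribution of
  the real and the imaginary part.
\<close>

lemma gauss_abs_cdot_nn:
  "(\<integral>\<^sup>+\<omega>. ennreal (cmod (cdot N (gvec \<omega>) \<xi>)) \<partial>gauss N) = ennreal (kappa * nrm N \<xi>)"
proof -
  interpret G: prob_space "gauss N" by (rule prob_space_gauss)
  interpret pair_sigma_finite "gauss N" lborel ..
  let ?c = "\<lambda>\<omega>. cdot N (gvec \<omega>) \<xi>"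
  let ?h = "\<lambda>\<omega> \<theta>. ennreal \<bar>cos \<theta> * Re (?c \<omega>) + sin \<theta> * Im (?c \<omega>)\<bar> * indicator {0..pi} \<theta>"
  have inner: "(\<integral>\<^sup>+\<omega>. ?h \<omega> \<theta> \<partial>gauss N) = ennreal (nrm N \<xi> / sqrt pi) * indicator {0..pi} \<theta>" for \<theta>
  proof -
    have "(\<integral>\<^sup>+\<omega>. ennreal \<bar>cos \<theta> * Re (?c \<omega>) + sin \<theta> * Im (?c \<omega>)\<bar> \<partial>gauss N)
        = ennreal (sqrt (2 / pi) * sqrt ((nrm N \<xi>)\<^sup>2 / 2))"
      unfolding cdot_gvec_rotated sum_rot_coeff_sq[of \<theta>, symmetric]
      using gauss_linear_moments(1)[of N "rot_coeff \<theta> \<xi>"]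
      by (subst nn_integral_eq_integral) (auto simp: has_bochner_integral_iff)
    also have "sqrt (2 / pi) * sqrt ((nrm N \<xi>)\<^sup>2 / 2) = nrm N \<xi> / sqrt pi"
      by (simp add: real_sqrt_divide)
    finally show ?thesis by (subst nn_integral_multc) auto
  qed
  have "2 * (\<integral>\<^sup>+\<omega>. ennreal (cmod (?c \<omega>)) \<partial>gauss N) = (\<integral>\<^sup>+\<omega>. ennreal (2 * cmod (?c \<omega>)) \<partial>gauss N)"
    by (subst nn_integral_cmult[symmetric]) (auto simp: ennreal_mult cmod_def)
  also have "\<dots> = (\<integral>\<^sup>+\<omega>. (\<integral>\<^sup>+\<theta>. ?h \<omega> \<theta> \<partial>lborel) \<partial>gauss N)"
    unfolding nn_integral_abs_sinusoid by (simp add: cmod_def)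
  also have "\<dots> = (\<integral>\<^sup>+\<theta>. (\<integral>\<^sup>+\<omega>. ?h \<omega> \<theta> \<partial>gauss N) \<partial>lborel)"
    by (rule Fubini'[symmetric]) measurable
  also have "\<dots> = ennreal (nrm N \<xi> / sqrt pi) * ennreal pi"
    unfolding inner by (simp add: nn_integral_cmult)
  also have "\<dots> = ennreal (2 * (kappa * nrm N \<xi>))"
  proof -
    have "nrm N \<xi> / sqrt pi * pi = 2 * (kappa * nrm N \<xi>)"
      using real_div_sqrt[of pi] by (simp add: kappa_def field_simps)
    then show ?thesis by (simp flip: ennreal_mult)
  qed
  also have "\<dots> = 2 * ennreal (kappa * nrm N \<xi>)"
    by (simp add: ennreal_mult')
  finally show ?thesis by (simp add: ennreal_mult_cancel_left)
qed

lemma gauss_abs_cdot: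
  "has_bochner_integral (gauss N) (\<lambda>\<omega>. cmod (cdot N (gvec \<omega>) \<xi>)) (kappa * nrm N \<xi>)"
proof (rule has_bochner_integral_nn_integral)
  show "(\<lambda>\<omega>. cmod (cdot N (gvec \<omega>) \<xi>)) \<in> borel_measurable (gauss N)"
    unfolding cmod_def by measurable
qed (simp_all add: gauss_abs_cdot_nn, simp add: kappa_def)

lemma gauss_cdot_sq:
  "has_bochner_integral (gauss N) (\<lambda>\<omega>. (cmod (cdot N (gvec \<omega>) \<xi>))\<^sup>2) ((nrm N \<xi>)\<^sup>2)"
proof -
  have "has_bochner_integral (gauss N) (\<lambda>\<omega>. (Re (cdot N (gvec \<omega>) \<xi>))\<^sup>2 + (Im (cdot N (gvec \<omega>) \<xi>))\<^sup>2)
          ((nrm N \<xi>)\<^sup>2 / 2 + (nrm N \<xi>)\<^sup>2 / 2)"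
    using gauss_linear_moments(2)[of N "rot_coeff 0 \<xi>"] gauss_linear_moments(2)[of N "rot_coeff (pi/2) \<xi>"]
    unfolding sum_rot_coeff_sq cdot_gvec_rotated[symmetric]
    by (intro has_bochner_integral_add) simp_all
  then show ?thesis by (simp add: cmod_power2)
qed

lemma gauss_coord_sq:
  assumes "i \<in> gauss_index N"
  shows "has_bochner_integral (gauss N) (\<lambda>\<omega>. (\<omega> i)\<^sup>2) 1"
    and "has_bochner_integral (gauss N) (\<lambda>\<omega>. (\<omega> i)^4) 3"
proof -
  interpret prob_space "gauss N" by (rule prob_space_gauss)
  note D = gauss_coord_distributed[OF assms]
  show "has_bochner_integral (gauss N) (\<lambda>\<omega>. (\<omega> i)\<^sup>2) 1"
    using distributed_integral[OF D, of "\<lambda>x. x\<^sup>2"] distributed_integrable[OF D, of "\<lambda>x. x\<^sup>2"]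
      normal_moment_even[of 1 0 1] by (simp add: has_bochner_integral_iff fact_numeral)
  show "has_bochner_integral (gauss N) (\<lambda>\<omega>. (\<omega> i)^4) 3"
    using distributed_integral[OF D, of "\<lambda>x. x^4"] distributed_integrable[OF D, of "\<lambda>x. x^4"]
      normal_moment_even[of 1 0 2] by (simp add: has_bochner_integral_iff fact_numeral)
qed

lemma gauss_coord_sq_prod:
  assumes ij: "i \<in> gauss_index N" "j \<in> gauss_index N"
  shows "has_bochner_integral (gauss N) (\<lambda>\<omega>. (\<omega> i)\<^sup>2 * (\<omega> j)\<^sup>2) (if i = j then 3 else 1)"
proof (cases "i = j")
  case True
  then show ?thesis using gauss_coord_sq(2)[OF ij(1)] by (simp flip: power_add)
next
  case False
  interpret prob_space "gauss N" by (rule prob_space_gauss)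
  have "indep_vars (\<lambda>_. borel) (\<lambda>k \<omega>. (\<omega> k)\<^sup>2) {i, j}"
    using indep_vars_compose[OF gauss_coord_indep[of "{i,j}" N], of "\<lambda>_ x. x\<^sup>2" "\<lambda>_. borel"] ij
    by (simp add: o_def)
  then have "integrable (gauss N) (\<lambda>\<omega>. \<Prod>k\<in>{i,j}. (\<omega> k)\<^sup>2) \<and> (\<integral>\<omega>. (\<Prod>k\<in>{i,j}. (\<omega> k)\<^sup>2) \<partial>gauss N) = (\<Prod>k\<in>{i,j}. \<integral>\<omega>. (\<omega> k)\<^sup>2 \<partial>gauss N)"
    using indep_vars_lebesgue_integral[of "{i,j}" "\<lambda>k \<omega>. (\<omega> k)\<^sup>2"] indep_vars_integrable[of "{i,j}" "\<lambda>k \<omega>. (\<omega> k)\<^sup>2"]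
      gauss_coord_sq(1)[OF ij(1)] gauss_coord_sq(1)[OF ij(2)]
    by (auto simp: has_bochner_integral_iff)
  then show ?thesis using False gauss_coord_sq(1)[OF ij(1)] gauss_coord_sq(1)[OF ij(2)]
    by (simp add: has_bochner_integral_iff)
qed

lemma card_gauss_index: "card (gauss_index N) = 2 * N"
  by (simp add: gauss_index_def card_cartesian_product mult.commute)

lemma gauss_nrm_moments:
  "has_bochner_integral (gauss N) (\<lambda>\<omega>. (nrm N (gvec \<omega>))\<^sup>2) (real N)"
  "has_bochner_integral (gauss N) (\<lambda>\<omega>. (nrm N (gvec \<omega>))^4) ((real N)\<^sup>2 + real N)"
proof -
  let ?I = "gauss_index N"
  have "has_bochner_integral (gauss N) (\<lambda>\<omega>. (\<Sum>i\<in>?I. (\<omega> i)\<^sup>2) / 2) ((\<Sum>i\<in>?I. 1) / 2)"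
    by (intro has_bochner_integral_divide_zero has_bochner_integral_sum gauss_coord_sq(1))
  then show "has_bochner_integral (gauss N) (\<lambda>\<omega>. (nrm N (gvec \<omega>))\<^sup>2) (real N)"
    by (simp add: nrm_gvec_sq card_gauss_index)
  have fourth: "has_bochner_integral (gauss N) (\<lambda>\<omega>. (\<Sum>i\<in>?I. \<Sum>j\<in>?I. (\<omega> i)\<^sup>2 * (\<omega> j)\<^sup>2) / 4)
      ((\<Sum>i\<in>?I. \<Sum>j\<in>?I. (if i = j then 3 else 1)) / 4)"
    by (intro has_bochner_integral_divide_zero has_bochner_integral_sum gauss_coord_sq_prod)
  have "(\<Sum>j\<in>?I. (if i = j then 3 else 1)) = 2 + 2 * real N" if "i \<in> ?I" for i
  proof -
    have "(\<Sum>j\<in>?I. (if i = j then 3 else 1)) = (\<Sum>j\<in>?I. (if i = j then 2 else 0) + (1::real))"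
      by (intro sum.cong) auto
    then show ?thesis using that by (simp add: sum.distrib card_gauss_index)
  qed
  then have count: "(\<Sum>i\<in>?I. \<Sum>j\<in>?I. (if i = j then 3 else 1)) / 4 = (real N)\<^sup>2 + real N"
    by (simp add: card_gauss_index power2_eq_square algebra_simps)
  have "(nrm N (gvec \<omega>))^4 = (\<Sum>i\<in>?I. \<Sum>j\<in>?I. (\<omega> i)\<^sup>2 * (\<omega> j)\<^sup>2) / 4" for \<omega>
  proof -
    have "(nrm N (gvec \<omega>))^4 = ((nrm N (gvec \<omega>))\<^sup>2)\<^sup>2" by simp
    also have "\<dots> = ((\<Sum>i\<in>?I. (\<omega> i)\<^sup>2) * (\<Sum>i\<in>?I. (\<omega> i)\<^sup>2)) / 4"
      unfolding nrm_gvec_sq by (simp add: power2_eq_square)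
    finally show ?thesis by (simp add: sum_product)
  qed
  then show "has_bochner_integral (gauss N) (\<lambda>\<omega>. (nrm N (gvec \<omega>))^4) ((real N)\<^sup>2 + real N)"
    using fourth unfolding count by presburger
qed

lemma measurable_nrm_gvec [measurable]: "(\<lambda>\<omega>. nrm N (gvec \<omega>)) \<in> borel_measurable (gauss N)"
proof -
  have "nrm N (gvec \<omega>) = sqrt ((\<Sum>i\<in>gauss_index N. (\<omega> i)\<^sup>2) / 2)" for \<omega>
    by (metis nrm_gvec_sq nrm_nonneg real_sqrt_abs abs_of_nonneg)
  then show ?thesis by simp
qed

text \<open>
  The inequality \<open>3 t\<^sup>2 - t\<^sup>4 \<le> 2 t\<close>, which is \<open>t (t - 1)\<^sup>2 (t + 2) \<ge> 0\<close>, bounds the first moment of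
  \<open>t = \<parallel>g\<parallel> / sqrt N\<close> from below by its second and fourth moments, which are 1 and \<open>1 + 1 / N\<close>.
\<close>

lemma gauss_nrm_lower:
  assumes "N \<ge> 1"
  shows "integrable (gauss N) (\<lambda>\<omega>. nrm N (gvec \<omega>))"
    and "sqrt N * (1 - 1 / (2 * real N)) \<le> (\<integral>\<omega>. nrm N (gvec \<omega>) \<partial>gauss N)"
proof -
  interpret prob_space "gauss N" by (rule prob_space_gauss)
  let ?n = "\<lambda>\<omega>. nrm N (gvec \<omega>)"
  note mom = gauss_nrm_moments[of N, unfolded has_bochner_integral_iff]
  have le: "t \<le> 1 + t\<^sup>2" for t :: real
    using zero_le_power2[of "t - 1 / 2"] by (simp add: power2_eq_square algebra_simps)
  show int: "integrable (gauss N) ?n"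
    by (rule Bochner_Integration.integrable_bound[of _ "\<lambda>\<omega>. 1 + (?n \<omega>)\<^sup>2"])
       (use mom le in \<open>auto simp: abs_of_nonneg\<close>)
  define s where "s = sqrt N"
  have s: "s > 0" "s\<^sup>2 = N" using assms by (simp_all add: s_def)
  have poly: "3 * t\<^sup>2 - t^4 \<le> 2 * t" if "0 \<le> t" for t :: real
  proof -
    have "2 * t - (3 * t\<^sup>2 - t^4) = t * ((t - 1)\<^sup>2 * (t + 2))"
      by (simp add: eval_nat_numeral algebra_simps)
    moreover have "0 \<le> t * ((t - 1)\<^sup>2 * (t + 2))" using that by simp
    ultimately show ?thesis by linarith
  qed
  have "(3 * (?n \<omega>)\<^sup>2 / real N - (?n \<omega>)^4 / (real N)\<^sup>2) * (s / 2) \<le> ?n \<omega>" for \<omega>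
  proof -
    have "s^4 = (s\<^sup>2)\<^sup>2" by simp
    then have s4: "s^4 = (real N)\<^sup>2" by (simp add: s(2))
    have "3 * (?n \<omega> / s)\<^sup>2 - (?n \<omega> / s)^4 \<le> 2 * (?n \<omega> / s)" using s by (intro poly) simp
    then have "(3 * (?n \<omega>)\<^sup>2 / real N - (?n \<omega>)^4 / (real N)\<^sup>2) \<le> 2 * (?n \<omega> / s)"
      by (simp add: power_divide s(2) s4)
    then have "(3 * (?n \<omega>)\<^sup>2 / real N - (?n \<omega>)^4 / (real N)\<^sup>2) * (s / 2) \<le> 2 * (?n \<omega> / s) * (s / 2)"
      using s(1) by (intro mult_right_mono) auto
    then show ?thesis using s(1) by simp
  qed
  then have "(\<integral>\<omega>. (3 * (?n \<omega>)\<^sup>2 / real N - (?n \<omega>)^4 / (real N)\<^sup>2) * (s / 2) \<partial>gauss N) \<le> (\<integral>\<omega>. ?n \<omega> \<partial>gauss N)"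
    using mom int by (intro integral_mono) auto
  also have "(\<integral>\<omega>. (3 * (?n \<omega>)\<^sup>2 / real N - (?n \<omega>)^4 / (real N)\<^sup>2) * (s / 2) \<partial>gauss N)
      = (3 * real N / real N - ((real N)\<^sup>2 + real N) / (real N)\<^sup>2) * (s / 2)"
    using mom by simp
  also have "\<dots> = s * (1 - 1 / (2 * real N))"
    using assms by (simp add: field_simps power2_eq_square)
  also have "\<dots> = sqrt N * (1 - 1 / (2 * real N))" by (simp add: s_def)
  finally show "sqrt N * (1 - 1 / (2 * real N)) \<le> (\<integral>\<omega>. ?n \<omega> \<partial>gauss N)" .
qed

section \<open>Finite approximations of the Gaussian vector\<close>

lemma real_simple_approximation:
  "\<exists>s :: nat \<Rightarrow> real \<Rightarrow> real. (\<forall>m. s m \<in> borel_measurable borel \<and> finite (range (s m))) \<and>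
     (\<forall>x. (\<lambda>m. s m x) \<longlonglongrightarrow> x) \<and> (\<forall>m x. \<bar>s m x\<bar> \<le> 2 * \<bar>x\<bar>)"
proof -
  obtain s where s: "\<forall>m. simple_function borel (s m)" "\<forall>x\<in>space borel. (\<lambda>m. s m x) \<longlonglongrightarrow> (x::real)"
      "\<forall>m. \<forall>x\<in>space borel. dist (s m x) 0 \<le> 2 * dist x (0::real)"
    using borel_measurable_implies_sequence_metric[of "\<lambda>x::real. x" borel 0] by auto
  then show ?thesis
    using simple_functionD(1)[of borel "s _"]
    by (intro exI[of _ s]) (auto simp: borel_measurable_simple_function)
qed

lemma gvec_scaled_bound:
  assumes "\<And>i. i \<in> gauss_index N \<Longrightarrow> \<bar>\<omega>' i\<bar> \<le> 2 * \<bar>\<omega> i\<bar>"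
  shows "nrm N (gvec \<omega>') \<le> 2 * nrm N (gvec \<omega>)"
proof -
  have "(nrm N (gvec \<omega>'))\<^sup>2 \<le> (\<Sum>i\<in>gauss_index N. (2 * \<bar>\<omega> i\<bar>)\<^sup>2) / 2"
    unfolding nrm_gvec_sq using assms
    by (intro divide_right_mono sum_mono) (metis abs_ge_zero power2_abs power_mono, simp)
  also have "\<dots> = (2 * nrm N (gvec \<omega>))\<^sup>2"
    by (simp add: power_mult_distrib nrm_gvec_sq sum_distrib_left)
  finally show ?thesis by (rule power2_le_imp_le) simp
qed

lemma gvec_diff: "gvec \<omega> k - gvec \<omega>' k = gvec (\<lambda>i. \<omega> i - \<omega>' i) k"
  by (simp add: gvec_def complex_eq_iff diff_divide_distrib)

lemma nrm_reverse_triangle: "\<bar>nrm N u - nrm N w\<bar> \<le> nrm N (\<lambda>k. u k - w k)"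
proof -
  have "nrm N u \<le> nrm N w + nrm N (\<lambda>k. u k - w k)" for u w
    using nrm_triangle[of N w "\<lambda>k. u k - w k"] by simp
  from this[of u w] this[of w u] show ?thesis
    using nrm_scale[of N "-1" "\<lambda>k. u k - w k"] by simp
qed

lemma expectation_finite_range:
  assumes "finite_measure M" "finite V" "\<And>\<omega>. \<omega> \<in> space M \<Longrightarrow> \<sigma> \<omega> \<in> V"
    and "\<And>v. v \<in> V \<Longrightarrow> {\<omega> \<in> space M. \<sigma> \<omega> = v} \<in> sets M"
  shows "(\<integral>\<omega>. h (\<sigma> \<omega>) \<partial>M) = (\<Sum>v\<in>V. measure M {\<omega> \<in> space M. \<sigma> \<omega> = v} * (h v :: real))"
    and "integrable M (\<lambda>\<omega>. h (\<sigma> \<omega>))"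
proof -
  interpret finite_measure M by fact
  let ?A = "\<lambda>v. {\<omega> \<in> space M. \<sigma> \<omega> = v}"
  have eq: "h (\<sigma> \<omega>) = (\<Sum>v\<in>V. indicator (?A v) \<omega> * h v)" if "\<omega> \<in> space M" for \<omega>
  proof -
    have "(\<Sum>v\<in>V. indicator (?A v) \<omega> * h v) = (\<Sum>v\<in>V. if \<sigma> \<omega> = v then h v else 0)"
      using that by (intro sum.cong) (auto simp: indicator_def)
    then show ?thesis using assms(2) assms(3)[OF that] by simp
  qed
  have int: "integrable M (\<lambda>\<omega>. \<Sum>v\<in>V. indicator (?A v) \<omega> * h v)"
    using assms(4) by (intro Bochner_Integration.integrable_sum integrable_mult_left)
      (auto simp: less_top[symmetric] emeasure_eq_measure)
  show "integrable M (\<lambda>\<omega>. h (\<sigma> \<omega>))"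
    using int Bochner_Integration.integrable_cong[OF refl eq, of M] by simp
  have "(\<integral>\<omega>. h (\<sigma> \<omega>) \<partial>M) = (\<integral>\<omega>. (\<Sum>v\<in>V. indicator (?A v) \<omega> * h v) \<partial>M)"
    by (rule Bochner_Integration.integral_cong[OF refl eq])
  also have "\<dots> = (\<Sum>v\<in>V. measure M (?A v) * h v)"
    using assms(4) by (subst Bochner_Integration.integral_sum) (auto simp: less_top[symmetric] emeasure_eq_measure)
  finally show "(\<integral>\<omega>. h (\<sigma> \<omega>) \<partial>M) = (\<Sum>v\<in>V. measure M (?A v) * h v)" .
qed

text \<open>
  Each real coordinate is replaced by a simple function of it, and dominated convergence controls
  the error. The error \<open>e m = E \<parallel>g\<^sub>m - g\<parallel>\<close> of the first absolute moment is uniform over the unit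
  sphere, as the lower bound requires; for the second moment pointwise convergence suffices.
\<close>

lemma gaussian_discretisation:
  assumes N: "N \<ge> 1"
  shows "\<exists>(V :: nat \<Rightarrow> (nat \<times> bool \<Rightarrow> real) set) p e.
    (\<forall>m. finite (V m) \<and> (\<forall>v\<in>V m. 0 \<le> p m v) \<and> sum (p m) (V m) = 1) \<and> e \<longlonglongrightarrow> 0 \<and>
    (\<forall>m \<xi>. \<bar>(\<Sum>v\<in>V m. p m v * cmod (cdot N (gvec v) \<xi>)) - kappa * nrm N \<xi>\<bar> \<le> e m * nrm N \<xi>) \<and>
    (\<forall>\<xi>. (\<lambda>m. \<Sum>v\<in>V m. p m v * (cmod (cdot N (gvec v) \<xi>))\<^sup>2) \<longlonglongrightarrow> (nrm N \<xi>)\<^sup>2) \<and>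
    (\<forall>m. sqrt N * (1 - 1 / (2 * real N)) - e m \<le> (\<Sum>v\<in>V m. p m v * nrm N (gvec v)))"
proof -
  interpret G: prob_space "gauss N" by (rule prob_space_gauss)
  obtain s :: "nat \<Rightarrow> real \<Rightarrow> real" where s [measurable]: "\<And>m. s m \<in> borel_measurable borel"
    and fin: "\<And>m. finite (range (s m))" and lim: "\<And>x. (\<lambda>m. s m x) \<longlonglongrightarrow> x"
    and bound: "\<And>m x. \<bar>s m x\<bar> \<le> 2 * \<bar>x\<bar>"
    using real_simple_approximation by blast
  define \<sigma> where "\<sigma> m \<omega> = (\<lambda>i\<in>gauss_index N. s m (\<omega> i))" for m \<omega>
  define V where "V m = PiE (gauss_index N) (\<lambda>_. range (s m))" for m
  define p where "p m v = measure (gauss N) {\<omega> \<in> space (gauss N). \<sigma> m \<omega> = v}" for m v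
  define e where "e m = (\<integral>\<omega>. nrm N (\<lambda>k. gvec (\<sigma> m \<omega>) k - gvec \<omega> k) \<partial>gauss N)" for m
  have fV: "finite (V m)" for m unfolding V_def by (intro finite_PiE fin) simp
  have \<sigma>V: "\<sigma> m \<omega> \<in> V m" for m \<omega> by (auto simp: \<sigma>_def V_def)
  have \<sigma>_sets: "{\<omega> \<in> space (gauss N). \<sigma> m \<omega> = v} \<in> sets (gauss N)" if "v \<in> V m" for m v
  proof -
    have "{\<omega> \<in> space (gauss N). \<sigma> m \<omega> = v} = {\<omega> \<in> space (gauss N). \<forall>i\<in>gauss_index N. s m (\<omega> i) = v i}"
      using that by (auto simp: \<sigma>_def V_def PiE_iff extensional_def fun_eq_iff restrict_def)
    also have "\<dots> \<in> sets (gauss N)" by measurable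
    finally show ?thesis .
  qed
  have E_fin: "(\<integral>\<omega>. h (\<sigma> m \<omega>) \<partial>gauss N) = (\<Sum>v\<in>V m. p m v * h v)"
    and E_int: "integrable (gauss N) (\<lambda>\<omega>. h (\<sigma> m \<omega>))" for h :: "(nat \<times> bool \<Rightarrow> real) \<Rightarrow> real" and m
    unfolding p_def using expectation_finite_range[of "gauss N" "V m" "\<sigma> m" h] fV \<sigma>V \<sigma>_sets
    by (auto intro: G.finite_measure_axioms)
  have p1: "sum (p m) (V m) = 1" for m using E_fin[of "\<lambda>_. 1"] G.prob_space by simp
  have \<sigma>_lim: "(\<lambda>m. \<sigma> m \<omega> i) \<longlonglongrightarrow> \<omega> i" if "i \<in> gauss_index N" for \<omega> i
    using lim that by (simp add: \<sigma>_def)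
  have gvec_lim: "(\<lambda>m. gvec (\<sigma> m \<omega>) k) \<longlonglongrightarrow> gvec \<omega> k" if "k < N" for \<omega> k
    unfolding gvec_def using that by (intro tendsto_intros \<sigma>_lim) auto
  have bnd: "nrm N (gvec (\<sigma> m \<omega>)) \<le> 2 * nrm N (gvec \<omega>)" for m \<omega>
    by (rule gvec_scaled_bound) (simp add: \<sigma>_def bound)
  note mom = gauss_nrm_moments(1)[of N, unfolded has_bochner_integral_iff]
  note low = gauss_nrm_lower[OF N]
  have meas_diff: "(\<lambda>\<omega>. nrm N (\<lambda>k. gvec (\<sigma> m \<omega>) k - gvec \<omega> k)) \<in> borel_measurable (gauss N)" for m
  proof -
    have "nrm N (\<lambda>k. gvec (\<sigma> m \<omega>) k - gvec \<omega> k) = sqrt ((\<Sum>i\<in>gauss_index N. (s m (\<omega> i) - \<omega> i)\<^sup>2) / 2)" for \<omega>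
    proof -
      have "(nrm N (\<lambda>k. gvec (\<sigma> m \<omega>) k - gvec \<omega> k))\<^sup>2 = (\<Sum>i\<in>gauss_index N. (s m (\<omega> i) - \<omega> i)\<^sup>2) / 2"
        unfolding gvec_diff nrm_gvec_sq by (simp add: \<sigma>_def)
      then show ?thesis by (metis nrm_nonneg real_sqrt_abs abs_of_nonneg)
    qed
    then show ?thesis by simp
  qed
  have diff_bnd: "nrm N (\<lambda>k. gvec (\<sigma> m \<omega>) k - gvec \<omega> k) \<le> 3 * nrm N (gvec \<omega>)" for m \<omega>
    using nrm_triangle[of N "gvec (\<sigma> m \<omega>)" "\<lambda>k. - gvec \<omega> k"] bnd[of m \<omega>] nrm_scale[of N "-1" "gvec \<omega>"] by simp
  have int_diff: "integrable (gauss N) (\<lambda>\<omega>. nrm N (\<lambda>k. gvec (\<sigma> m \<omega>) k - gvec \<omega> k))" for m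
    by (rule Bochner_Integration.integrable_bound[of _ "\<lambda>\<omega>. 3 * nrm N (gvec \<omega>)"])
       (use low diff_bnd meas_diff in auto)
  have e_lim: "e \<longlonglongrightarrow> 0"
  proof -
    have "(\<lambda>m. nrm N (\<lambda>k. gvec (\<sigma> m \<omega>) k - gvec \<omega> k)) \<longlonglongrightarrow> 0" for \<omega>
    proof -
      have "(\<lambda>m. sqrt (\<Sum>k<N. (cmod (gvec (\<sigma> m \<omega>) k - gvec \<omega> k))\<^sup>2)) \<longlonglongrightarrow> sqrt (\<Sum>k<N. (cmod (gvec \<omega> k - gvec \<omega> k))\<^sup>2)"
        by (intro tendsto_intros gvec_lim) auto
      moreover have "sqrt (\<Sum>k<N. (cmod (gvec \<omega> k - gvec \<omega> k))\<^sup>2) = 0" by simp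
      ultimately show ?thesis by (simp only: nrm_def L2_set_def)
    qed
    then have "e \<longlonglongrightarrow> (\<integral>\<omega>. 0 \<partial>gauss N)"
      unfolding e_def
      by (intro integral_dominated_convergence[where w = "\<lambda>\<omega>. 3 * nrm N (gvec \<omega>)"])
         (use low diff_bnd meas_diff in auto)
    then show ?thesis by simp
  qed
  have e_cdot: "\<bar>(\<Sum>v\<in>V m. p m v * cmod (cdot N (gvec v) \<xi>)) - kappa * nrm N \<xi>\<bar> \<le> e m * nrm N \<xi>" for m \<xi>
  proof -
    have i1: "integrable (gauss N) (\<lambda>\<omega>. cmod (cdot N (gvec \<omega>) \<xi>))"
      and k1: "(\<integral>\<omega>. cmod (cdot N (gvec \<omega>) \<xi>) \<partial>gauss N) = kappa * nrm N \<xi>"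
      using gauss_abs_cdot[of N \<xi>] by (auto simp: has_bochner_integral_iff)
    have i2: "integrable (gauss N) (\<lambda>\<omega>. cmod (cdot N (gvec (\<sigma> m \<omega>)) \<xi>))" by (rule E_int)
    have "\<bar>(\<Sum>v\<in>V m. p m v * cmod (cdot N (gvec v) \<xi>)) - kappa * nrm N \<xi>\<bar>
        = \<bar>\<integral>\<omega>. (cmod (cdot N (gvec (\<sigma> m \<omega>)) \<xi>) - cmod (cdot N (gvec \<omega>) \<xi>)) \<partial>gauss N\<bar>"
      using i1 i2 by (simp add: k1 E_fin[of "\<lambda>v. cmod (cdot N (gvec v) \<xi>)"])
    also have "\<dots> \<le> (\<integral>\<omega>. \<bar>cmod (cdot N (gvec (\<sigma> m \<omega>)) \<xi>) - cmod (cdot N (gvec \<omega>) \<xi>)\<bar> \<partial>gauss N)"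
      by (rule integral_abs_bound)
    also have "\<dots> \<le> (\<integral>\<omega>. nrm N (\<lambda>k. gvec (\<sigma> m \<omega>) k - gvec \<omega> k) * nrm N \<xi> \<partial>gauss N)"
    proof (rule integral_mono)
      fix \<omega>
      have "\<bar>cmod (cdot N (gvec (\<sigma> m \<omega>)) \<xi>) - cmod (cdot N (gvec \<omega>) \<xi>)\<bar>
          \<le> cmod (cdot N (\<lambda>k. gvec (\<sigma> m \<omega>) k - gvec \<omega> k) \<xi>)"
        unfolding cdot_diff_left by (rule norm_triangle_ineq3)
      also have "\<dots> \<le> nrm N (\<lambda>k. gvec (\<sigma> m \<omega>) k - gvec \<omega> k) * nrm N \<xi>" by (rule cdot_cauchy_schwarz)
      finally show "\<bar>cmod (cdot N (gvec (\<sigma> m \<omega>)) \<xi>) - cmod (cdot N (gvec \<omega>) \<xi>)\<bar>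
          \<le> nrm N (\<lambda>k. gvec (\<sigma> m \<omega>) k - gvec \<omega> k) * nrm N \<xi>" .
    qed (use i1 i2 int_diff in auto)
    also have "\<dots> = e m * nrm N \<xi>" by (simp add: e_def)
    finally show ?thesis .
  qed
  have sq_lim: "(\<lambda>m. \<Sum>v\<in>V m. p m v * (cmod (cdot N (gvec v) \<xi>))\<^sup>2) \<longlonglongrightarrow> (nrm N \<xi>)\<^sup>2" for \<xi>
  proof -
    have "(\<lambda>m. cdot N (gvec (\<sigma> m \<omega>)) \<xi>) \<longlonglongrightarrow> cdot N (gvec \<omega>) \<xi>" for \<omega>
      unfolding cdot_def by (intro tendsto_intros gvec_lim) auto
    then have ptw: "(\<lambda>m. (cmod (cdot N (gvec (\<sigma> m \<omega>)) \<xi>))\<^sup>2) \<longlonglongrightarrow> (cmod (cdot N (gvec \<omega>) \<xi>))\<^sup>2" for \<omega>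
      by (intro tendsto_intros)
    have dom: "(cmod (cdot N (gvec (\<sigma> m \<omega>)) \<xi>))\<^sup>2 \<le> 4 * (nrm N \<xi>)\<^sup>2 * (nrm N (gvec \<omega>))\<^sup>2" for m \<omega>
    proof -
      have "cmod (cdot N (gvec (\<sigma> m \<omega>)) \<xi>) \<le> nrm N (gvec (\<sigma> m \<omega>)) * nrm N \<xi>" by (rule cdot_cauchy_schwarz)
      also have "\<dots> \<le> 2 * nrm N (gvec \<omega>) * nrm N \<xi>" using bnd by (intro mult_right_mono) auto
      finally have "(cmod (cdot N (gvec (\<sigma> m \<omega>)) \<xi>))\<^sup>2 \<le> (2 * nrm N (gvec \<omega>) * nrm N \<xi>)\<^sup>2"
        by (intro power_mono) auto
      then show ?thesis by (simp add: power_mult_distrib mult_ac)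
    qed
    have "(\<lambda>m. \<integral>\<omega>. (cmod (cdot N (gvec (\<sigma> m \<omega>)) \<xi>))\<^sup>2 \<partial>gauss N) \<longlonglongrightarrow> (\<integral>\<omega>. (cmod (cdot N (gvec \<omega>) \<xi>))\<^sup>2 \<partial>gauss N)"
      by (rule integral_dominated_convergence[where w = "\<lambda>\<omega>. 4 * (nrm N \<xi>)\<^sup>2 * (nrm N (gvec \<omega>))\<^sup>2"])
         (use mom dom ptw gauss_cdot_sq[of N \<xi>] E_int[of "\<lambda>v. (cmod (cdot N (gvec v) \<xi>))\<^sup>2"] in
            \<open>auto simp: has_bochner_integral_iff\<close>)
    then show ?thesis
      using gauss_cdot_sq[of N \<xi>] E_fin[of "\<lambda>v. (cmod (cdot N (gvec v) \<xi>))\<^sup>2"]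
      by (simp add: has_bochner_integral_iff)
  qed
  have low': "sqrt N * (1 - 1 / (2 * real N)) - e m \<le> (\<Sum>v\<in>V m. p m v * nrm N (gvec v))" for m
  proof -
    have "(\<integral>\<omega>. nrm N (gvec \<omega>) - nrm N (\<lambda>k. gvec (\<sigma> m \<omega>) k - gvec \<omega> k) \<partial>gauss N) \<le> (\<integral>\<omega>. nrm N (gvec (\<sigma> m \<omega>)) \<partial>gauss N)"
    proof (rule integral_mono)
      fix \<omega>
      show "nrm N (gvec \<omega>) - nrm N (\<lambda>k. gvec (\<sigma> m \<omega>) k - gvec \<omega> k) \<le> nrm N (gvec (\<sigma> m \<omega>))"
        using nrm_reverse_triangle[of N "gvec (\<sigma> m \<omega>)" "gvec \<omega>"] by simp
    qed (use low(1) int_diff E_int[of "\<lambda>v. nrm N (gvec v)"] in auto)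
    then show ?thesis
      using low int_diff by (simp add: e_def E_fin[of "\<lambda>v. nrm N (gvec v)"])
  qed
  show ?thesis
    using fV p1 e_lim e_cdot sq_lim low'
    by (intro exI[of _ V] exI[of _ p] exI[of _ e]) (auto simp: p_def)
qed

section \<open>The upper bound\<close>

lemma kappa_pos: "kappa > 0" by (simp add: kappa_def)

lemma torus_form_nonneg: "torus_weights n V p z \<Longrightarrow> 0 \<le> torus_form n V p z a"
  unfolding torus_form_def torus_weights_def by (intro sum_nonneg) auto

text \<open>
  The value at 0 keeps the phase unimodular everywhere, so that phases of inner products are always
  points of the torus.
\<close>

definition phase :: "complex \<Rightarrow> complex" where
  "phase c = (if c = 0 then 1 else cnj c / cmod c)"

lemma norm_phase: "cmod (phase c) = 1"
  by (simp add: phase_def norm_divide)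

lemma mult_phase: "c * phase c = cmod c"
proof (cases "c = 0")
  case False
  then have "c * phase c = (c * cnj c) / cmod c" by (simp add: phase_def)
  also have "\<dots> = cmod c" using False
    by (simp add: complex_norm_square[symmetric] power2_eq_square)
  finally show ?thesis .
qed (simp add: phase_def)

lemma weighted_cauchy_schwarz:
  fixes p A B :: "'v \<Rightarrow> real"
  assumes "\<forall>v\<in>V. 0 \<le> p v"
  shows "(\<Sum>v\<in>V. p v * (A v * B v)) \<le> sqrt (\<Sum>v\<in>V. p v * (A v)\<^sup>2) * sqrt (\<Sum>v\<in>V. p v * (B v)\<^sup>2)"
proof -
  have "(\<Sum>v\<in>V. p v * (A v * B v)) \<le> (\<Sum>v\<in>V. \<bar>sqrt (p v) * A v\<bar> * \<bar>sqrt (p v) * B v\<bar>)"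
  proof (rule sum_mono)
    fix v assume "v \<in> V"
    then have "p v = sqrt (p v) * sqrt (p v)" using assms by simp
    then have "p v * (A v * B v) = (sqrt (p v) * A v) * (sqrt (p v) * B v)" by (simp add: mult_ac)
    also have "\<dots> \<le> \<bar>sqrt (p v) * A v\<bar> * \<bar>sqrt (p v) * B v\<bar>"
      by (metis abs_ge_self abs_mult)
    finally show "p v * (A v * B v) \<le> \<bar>sqrt (p v) * A v\<bar> * \<bar>sqrt (p v) * B v\<bar>" .
  qed
  also have "\<dots> \<le> L2_set (\<lambda>v. sqrt (p v) * A v) V * L2_set (\<lambda>v. sqrt (p v) * B v) V"
    by (rule L2_set_mult_ineq)
  also have "\<dots> = sqrt (\<Sum>v\<in>V. p v * (A v)\<^sup>2) * sqrt (\<Sum>v\<in>V. p v * (B v)\<^sup>2)"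
    using assms by (simp add: L2_set_def power_mult_distrib)
  finally show ?thesis .
qed

lemma nrm_perturb_le:
  assumes "nrm N x = 1"
  shows "nrm N (\<lambda>k. x k + of_real t * \<xi> k) \<le> 1 + t * Re (cdot N x \<xi>) + t\<^sup>2 * (nrm N \<xi>)\<^sup>2 / 2"
proof -
  let ?y = "\<lambda>k. x k + of_real t * \<xi> k"
  have "complex_of_real ((nrm N ?y)\<^sup>2) = cdot N x x + of_real t * cdot N x \<xi> + of_real t * cdot N \<xi> x + of_real (t\<^sup>2) * cdot N \<xi> \<xi>"
    unfolding cdot_self[symmetric] cdot_add_left cdot_add_right cdot_scale_left cdot_scale_right
    by (simp add: power2_eq_square algebra_simps)
  also have "\<dots> = of_real (1 + 2 * t * Re (cdot N x \<xi>) + t\<^sup>2 * (nrm N \<xi>)\<^sup>2)"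
    unfolding cdot_self cdot_commute[of N \<xi> x] assms
    by (simp add: complex_eq_iff)
  finally have "(nrm N ?y)\<^sup>2 = 1 + 2 * t * Re (cdot N x \<xi>) + t\<^sup>2 * (nrm N \<xi>)\<^sup>2"
    using of_real_eq_iff by blast
  moreover have "2 * nrm N ?y \<le> (nrm N ?y)\<^sup>2 + 1"
    using zero_le_power2[of "nrm N ?y - 1"] by (simp add: power2_eq_square algebra_simps)
  ultimately show ?thesis by simp
qed

text \<open>
  An approximate form of differentiating \<open>E \<bar>\<langle>g, \<eta>\<rangle>\<bar> = \<kappa> \<parallel>\<eta>\<parallel>\<close> at a unit vector \<open>x\<close>. The left
  side is convex in \<open>\<eta>\<close>, and the phases at \<open>x\<close> provide a subgradient; the right side is differentiable,
  so steps of size \<open>t\<close> in the directions \<open>\<xi>\<close> and \<open>-\<xi>\<close> determine that subgradient up to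
  \<open>O(t) + O(e / t)\<close>.
\<close>

lemma phase_average_estimate:
  fixes y :: "'v \<Rightarrow> nat \<Rightarrow> complex"
  assumes p: "\<forall>v\<in>V. 0 \<le> p v"
    and e: "\<And>\<eta>. \<bar>(\<Sum>v\<in>V. p v * cmod (cdot N (y v) \<eta>)) - \<kappa> * nrm N \<eta>\<bar> \<le> e * nrm N \<eta>"
    and x: "nrm N x = 1" and t: "t > 0" and \<kappa>: "0 \<le> \<kappa>" and "0 \<le> e"
  shows "\<bar>(\<Sum>v\<in>V. p v * Re (cdot N (y v) \<xi> * phase (cdot N (y v) x))) - \<kappa> * Re (cdot N x \<xi>)\<bar>
           \<le> \<kappa> * t * (nrm N \<xi>)\<^sup>2 / 2 + e * (2 + t * nrm N \<xi>) / t"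
proof -
  define L where "L = (\<Sum>v\<in>V. p v * Re (cdot N (y v) \<xi> * phase (cdot N (y v) x)))"
  define R where "R = Re (cdot N x \<xi>)"
  define f where "f \<eta> = (\<Sum>v\<in>V. p v * cmod (cdot N (y v) \<eta>))" for \<eta>
  have one: "\<tau> * L \<le> \<tau> * (\<kappa> * R) + t * (\<kappa> * t * (nrm N \<xi>)\<^sup>2 / 2 + e * (2 + t * nrm N \<xi>) / t)"
    if \<tau>: "\<bar>\<tau>\<bar> = t" for \<tau>
  proof -
    let ?w = "\<lambda>k. x k + of_real \<tau> * \<xi> k"
    have "f x + \<tau> * L \<le> f ?w"
      unfolding f_def L_def sum_distrib_left sum.distrib[symmetric]
    proof (rule sum_mono)
      fix v assume v: "v \<in> V"
      let ?u = "phase (cdot N (y v) x)"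
      have "cmod (cdot N (y v) x) + \<tau> * Re (cdot N (y v) \<xi> * ?u) = Re (cdot N (y v) ?w * ?u)"
        unfolding cdot_add_right cdot_scale_right distrib_right mult_phase
        by (simp add: mult.assoc)
      also have "\<dots> \<le> cmod (cdot N (y v) ?w * ?u)" by (rule complex_Re_le_cmod)
      also have "\<dots> = cmod (cdot N (y v) ?w)" by (simp add: norm_mult norm_phase)
      finally have "p v * (cmod (cdot N (y v) x) + \<tau> * Re (cdot N (y v) \<xi> * ?u)) \<le> p v * cmod (cdot N (y v) ?w)"
        using p v by (intro mult_left_mono) auto
      then show "p v * cmod (cdot N (y v) x) + \<tau> * (p v * Re (cdot N (y v) \<xi> * ?u)) \<le> p v * cmod (cdot N (y v) ?w)"
        by (simp add: algebra_simps)
    qed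
    moreover have "f ?w \<le> \<kappa> * nrm N ?w + e * nrm N ?w" using e[of ?w] by (simp add: f_def)
    moreover have "\<kappa> - e \<le> f x" using e[of x] x by (simp add: f_def)
    moreover have "\<kappa> * nrm N ?w \<le> \<kappa> * (1 + \<tau> * R + \<tau>\<^sup>2 * (nrm N \<xi>)\<^sup>2 / 2)"
      unfolding R_def using \<kappa> by (intro mult_left_mono nrm_perturb_le x)
    moreover have "e * nrm N ?w \<le> e * (1 + t * nrm N \<xi>)"
      using nrm_triangle[of N x "\<lambda>k. of_real \<tau> * \<xi> k"] nrm_scale[of N "of_real \<tau>" \<xi>] x \<tau> \<open>0 \<le> e\<close>
      by (intro mult_left_mono) auto
    moreover have "\<tau>\<^sup>2 = t * t" using \<tau> by (metis power2_abs power2_eq_square)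
    moreover have "t * (\<kappa> * t * (nrm N \<xi>)\<^sup>2 / 2 + e * (2 + t * nrm N \<xi>) / t)
        = \<kappa> * (t * t) * (nrm N \<xi>)\<^sup>2 / 2 + e * (2 + t * nrm N \<xi>)"
    proof -
      have "t * (A + B / t) = t * A + B" for A B using t by (simp add: distrib_left)
      then show ?thesis by simp
    qed
    ultimately show ?thesis by (simp add: algebra_simps)
  qed
  have "t * (L - \<kappa> * R) \<le> t * (\<kappa> * t * (nrm N \<xi>)\<^sup>2 / 2 + e * (2 + t * nrm N \<xi>) / t)"
    using one[of t] t by (simp add: right_diff_distrib)
  moreover have "t * (- (L - \<kappa> * R)) \<le> t * (\<kappa> * t * (nrm N \<xi>)\<^sup>2 / 2 + e * (2 + t * nrm N \<xi>) / t)"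
    using one[of "-t"] t by (simp add: right_diff_distrib)
  ultimately have "\<bar>L - \<kappa> * R\<bar> \<le> \<kappa> * t * (nrm N \<xi>)\<^sup>2 / 2 + e * (2 + t * nrm N \<xi>) / t"
    using t by (intro abs_leI) (simp_all only: mult_le_cancel_left_pos)
  then show ?thesis by (simp add: L_def R_def)
qed

text \<open>
  The phases of \<open>\<langle>g, x\<^sub>1\<rangle>, \<dots>, \<langle>g, x\<^sub>n\<rangle>\<close> form a random point of the torus. The average of
  \<open>\<langle>g, w\<rangle> \<Sum>\<^sub>j a\<^sub>j u\<^sub>j\<close>, where \<open>w = X a\<close>, has real part \<open>\<kappa> \<parallel>w\<parallel>\<^sup>2\<close> by the subgradient identity and is
  bounded by the Cauchy-Schwarz inequality. The argument runs for the finite approximations, and the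
  compactness of the torus forms carries it to the limit.
\<close>

lemma unit_columns_dominated:
  fixes x :: "nat \<Rightarrow> nat \<Rightarrow> complex"
  assumes N: "N \<ge> 1" and n: "n \<ge> 1" and x: "\<And>j. j < n \<Longrightarrow> nrm N (x j) = 1"
  shows "\<exists>l P Z. l \<le> n\<^sup>2 \<and> (\<forall>i<l. 0 < P i) \<and> torus_weights n {..<l::nat} P Z \<and>
    (\<forall>a. (kappa * nrm N (\<lambda>k. \<Sum>j<n. a j * x j k))\<^sup>2 \<le> torus_form n {..<l} P Z a)"
proof -
  obtain V p e where V: "\<forall>m. finite (V m) \<and> (\<forall>v\<in>V m. 0 \<le> p m v) \<and> sum (p m) (V m) = 1"
    and e0: "e \<longlonglongrightarrow> 0"
    and e: "\<forall>m \<xi>. \<bar>(\<Sum>v\<in>V m. p m v * cmod (cdot N (gvec v) \<xi>)) - kappa * nrm N \<xi>\<bar> \<le> e m * nrm N \<xi>"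
    and sq: "\<forall>\<xi>. (\<lambda>m. \<Sum>v\<in>V m. p m v * (cmod (cdot N (gvec v) \<xi>))\<^sup>2) \<longlonglongrightarrow> (nrm N \<xi>)\<^sup>2"
    using gaussian_discretisation[OF N] by (elim exE conjE)
  have e_nonneg: "0 \<le> e m" for m
  proof -
    have "nrm N (x 0) = 1" using x n by simp
    moreover have "0 \<le> e m * nrm N (x 0)" using e abs_ge_zero order_trans by blast
    ultimately show ?thesis by simp
  qed
  define u where "u v j = phase (cdot N (gvec v) (x j))" for v j
  have tw: "torus_weights n (V m) (p m) u" for m
    using V by (simp add: torus_weights_def u_def norm_phase)
  obtain l P Z r where l: "l \<le> n\<^sup>2" "\<forall>i<l. 0 < P i" "torus_weights n {..<l::nat} P Z" and r: "strict_mono r"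
    and lim: "\<And>a. (\<lambda>m. torus_form n (V (r m)) (p (r m)) u a) \<longlonglongrightarrow> torus_form n {..<l} P Z a"
    using torus_form_limit[of n V p "\<lambda>_. u", OF n tw] by blast
  define L where "L m j \<xi> = (\<Sum>v\<in>V m. p m v * Re (cdot N (gvec v) \<xi> * u v j))" for m j \<xi>
  have L_lim: "(\<lambda>m. L m j \<xi>) \<longlonglongrightarrow> kappa * Re (cdot N (x j) \<xi>)" if j: "j < n" for j \<xi>
  proof (rule LIMSEQ_I)
    fix \<epsilon> :: real assume \<epsilon>: "\<epsilon> > 0"
    define q where "q = nrm N \<xi>"
    \<comment> \<open>this step size makes the curvature term at most half of the tolerance\<close>
    define t where "t = \<epsilon> / (kappa * q\<^sup>2 + 1)"
    have den: "kappa * q\<^sup>2 + 1 > 0" using kappa_pos by (simp add: add_nonneg_pos)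
    have t: "t > 0" using \<epsilon> den by (simp add: t_def)
    have "kappa * t * q\<^sup>2 / 2 < \<epsilon> / 2"
    proof -
      have "t * (kappa * q\<^sup>2) < t * (kappa * q\<^sup>2 + 1)" using t by simp
      also have "\<dots> = \<epsilon>" using den by (simp add: t_def)
      finally show ?thesis by (simp add: mult_ac)
    qed
    moreover have "(\<lambda>m. e m * (2 + t * q) / t) \<longlonglongrightarrow> 0 * (2 + t * q) / t"
      using t by (intro tendsto_intros e0) auto
    then have "\<forall>\<^sub>F m in sequentially. e m * (2 + t * q) / t < \<epsilon> / 2"
      using \<epsilon> by (intro order_tendstoD(2)) auto
    then obtain m0 where "\<And>m. m \<ge> m0 \<Longrightarrow> e m * (2 + t * q) / t < \<epsilon> / 2"
      by (auto simp: eventually_sequentially)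
    moreover have "\<bar>L m j \<xi> - kappa * Re (cdot N (x j) \<xi>)\<bar> \<le> kappa * t * q\<^sup>2 / 2 + e m * (2 + t * q) / t" for m
      unfolding L_def u_def q_def
      by (rule phase_average_estimate) (use V e x j t kappa_pos e_nonneg in auto)
    ultimately show "\<exists>m0. \<forall>m\<ge>m0. norm (L m j \<xi> - kappa * Re (cdot N (x j) \<xi>)) < \<epsilon>"
      by (intro exI[of _ m0]) (smt (verit) field_sum_of_halves real_norm_def)
  qed
  have "(kappa * nrm N (\<lambda>k. \<Sum>j<n. a j * x j k))\<^sup>2 \<le> torus_form n {..<l} P Z a" for a
  proof -
    define w where "w = (\<lambda>k. \<Sum>j<n. a j * x j k)"
    \<comment> \<open>the conjugated coefficients move to the phases when the inner product is taken\<close>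
    define \<xi> where "\<xi> j = (\<lambda>k. cnj (a j) * w k)" for j
    have "(\<lambda>m. \<Sum>j<n. L m j (\<xi> j)) \<longlonglongrightarrow> (\<Sum>j<n. kappa * Re (cdot N (x j) (\<xi> j)))"
      by (intro tendsto_sum L_lim) auto
    moreover have "(\<Sum>j<n. kappa * Re (cdot N (x j) (\<xi> j))) = kappa * (nrm N w)\<^sup>2"
    proof -
      have "(\<Sum>j<n. cdot N (x j) (\<xi> j)) = cdot N w w"
        unfolding \<xi>_def cdot_scale_right w_def[THEN arg_cong[where f="\<lambda>v. cdot N v w"]] cdot_sum_left cdot_scale_left
        by simp
      then have "Re (\<Sum>j<n. cdot N (x j) (\<xi> j)) = (nrm N w)\<^sup>2" by (simp add: cdot_self)
      then show ?thesis by (simp flip: sum_distrib_left)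
    qed
    ultimately have lhs: "(\<lambda>m. \<Sum>j<n. L (r m) j (\<xi> j)) \<longlonglongrightarrow> kappa * (nrm N w)\<^sup>2"
      using LIMSEQ_subseq_LIMSEQ[OF _ r] by (simp add: o_def)
    have rhs: "(\<lambda>m. sqrt (\<Sum>v\<in>V (r m). p (r m) v * (cmod (cdot N (gvec v) w))\<^sup>2) * sqrt (torus_form n (V (r m)) (p (r m)) u a))
        \<longlonglongrightarrow> sqrt ((nrm N w)\<^sup>2) * sqrt (torus_form n {..<l} P Z a)"
      using LIMSEQ_subseq_LIMSEQ[OF spec[OF sq, of w] r]
      by (intro tendsto_intros lim) (simp add: o_def)
    have Re_mult_le: "Re (b * d) \<le> cmod b * cmod d" for b d
      by (metis complex_Re_le_cmod norm_mult)
    have "(\<Sum>j<n. L m j (\<xi> j)) \<le> sqrt (\<Sum>v\<in>V m. p m v * (cmod (cdot N (gvec v) w))\<^sup>2) * sqrt (torus_form n (V m) (p m) u a)" for m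
    proof -
      have "(\<Sum>j<n. L m j (\<xi> j)) = (\<Sum>v\<in>V m. p m v * Re (\<Sum>j<n. cdot N (gvec v) (\<xi> j) * u v j))"
        unfolding L_def by (subst sum.swap) (simp add: sum_distrib_left)
      also have "\<dots> = (\<Sum>v\<in>V m. p m v * Re (cdot N (gvec v) w * (\<Sum>j<n. a j * u v j)))"
        unfolding \<xi>_def cdot_scale_right by (simp add: sum_distrib_left mult_ac)
      also have "\<dots> \<le> (\<Sum>v\<in>V m. p m v * (cmod (cdot N (gvec v) w) * cmod (\<Sum>j<n. a j * u v j)))"
        using V by (intro sum_mono mult_left_mono Re_mult_le) auto
      also have "\<dots> \<le> sqrt (\<Sum>v\<in>V m. p m v * (cmod (cdot N (gvec v) w))\<^sup>2) * sqrt (torus_form n (V m) (p m) u a)"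
        unfolding torus_form_def using V by (intro weighted_cauchy_schwarz) auto
      finally show ?thesis .
    qed
    then have "kappa * (nrm N w)\<^sup>2 \<le> sqrt ((nrm N w)\<^sup>2) * sqrt (torus_form n {..<l} P Z a)"
      by (intro LIMSEQ_le[OF lhs rhs]) auto
    then have *: "nrm N w * (kappa * nrm N w) \<le> nrm N w * sqrt (torus_form n {..<l} P Z a)"
      by (simp add: power2_eq_square mult_ac)
    have "kappa * nrm N w \<le> sqrt (torus_form n {..<l} P Z a)"
    proof (cases "nrm N w = 0")
      case True
      then show ?thesis using torus_form_nonneg[OF l(3)] by simp
    next
      case False
      then have "nrm N w > 0" by (simp add: less_le)
      then show ?thesis using * by simp
    qed
    then have "(kappa * nrm N w)\<^sup>2 \<le> (sqrt (torus_form n {..<l} P Z a))\<^sup>2"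
      using kappa_pos by (intro power_mono) auto
    then show ?thesis using torus_form_nonneg[OF l(3)] by (simp add: w_def)
  qed
  then show ?thesis using l by (intro exI[of _ l] exI[of _ P] exI[of _ Z]) auto
qed

text \<open>
  The property of \<^term>\<open>factorization_constant\<close> in terms of quadratic forms, with the columns of the
  matrix given as a family of vectors and \<open>T\<close> any bound for their norms.
\<close>

definition dominates :: "nat \<Rightarrow> real \<Rightarrow> bool" where
  "dominates n c \<longleftrightarrow> (\<forall>m\<ge>1. \<forall>x T. (\<forall>j<n. nrm m (x j) \<le> T) \<longrightarrow>
     (\<exists>l P Z. l \<le> n\<^sup>2 \<and> (\<forall>i<l. 0 < P i) \<and> torus_weights n {..<l::nat} P Z \<and>
       (\<forall>a. (nrm m (\<lambda>k. \<Sum>j<n. a j * x j k))\<^sup>2 \<le> (c * T)\<^sup>2 * torus_form n {..<l} P Z a)))"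

lemma dominatesD:
  assumes "dominates n c" "m \<ge> 1" "\<And>j. j < n \<Longrightarrow> nrm m (x j) \<le> T"
  obtains l P Z where "l \<le> n\<^sup>2" "\<forall>i<l. 0 < P i" "torus_weights n {..<l::nat} P Z"
    "\<forall>a. (nrm m (\<lambda>k. \<Sum>j<n. a j * x j k))\<^sup>2 \<le> (c * T)\<^sup>2 * torus_form n {..<l} P Z a"
proof -
  have "\<forall>j<n. nrm m (x j) \<le> T" using assms(3) by simp
  with assms(1,2)[unfolded dominates_def] have "\<exists>l P Z. l \<le> n\<^sup>2 \<and> (\<forall>i<l. 0 < P i) \<and> torus_weights n {..<l::nat} P Z \<and>
       (\<forall>a. (nrm m (\<lambda>k. \<Sum>j<n. a j * x j k))\<^sup>2 \<le> (c * T)\<^sup>2 * torus_form n {..<l} P Z a)"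
    by simp
  then show ?thesis by (elim exE conjE) (rule that)
qed

text \<open>
  One extra coordinate turns columns of norm at most 1 into unit vectors, and dropping it again only
  decreases the dominated form.
\<close>

lemma dominates_inverse_kappa:
  assumes n: "n \<ge> 1"
  shows "dominates n (1 / kappa)"
  unfolding dominates_def
proof (intro allI impI)
  fix m :: nat and x :: "nat \<Rightarrow> nat \<Rightarrow> complex" and T
  assume m: "m \<ge> 1" and xT: "\<forall>j<n. nrm m (x j) \<le> T"
  \<comment> \<open>a positive scale also when all columns vanish\<close>
  define S where "S = (if T > 0 then T else 1)"
  have S: "S > 0" by (simp add: S_def)
  have "nrm m (x 0) \<le> T" using xT n by simp
  then have T: "T \<ge> 0" using nrm_nonneg[of m "x 0"] by linarith
  have cS: "cmod (complex_of_real (1 / S)) = 1 / S" unfolding norm_of_real using S by simp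
  have xS: "nrm m (x j) \<le> S" if "j < n" for j
    using xT that by (auto simp: S_def intro: order_trans[of _ T])
  define x' where "x' j k = (if k < m then of_real (1 / S) * x j k else of_real (sqrt (1 - (nrm m (x j) / S)\<^sup>2)))" for j k
  have unit: "nrm (Suc m) (x' j) = 1" if j: "j < n" for j
  proof -
    have "nrm m (x j) / S \<le> 1" using xS[OF j] S by simp
    then have le: "(nrm m (x j) / S)\<^sup>2 \<le> 1" using S by (intro power_le_one) auto
    have "(nrm (Suc m) (x' j))\<^sup>2 = (nrm m (\<lambda>k. of_real (1 / S) * x j k))\<^sup>2 + (cmod (x' j m))\<^sup>2"
      by (simp add: nrm_sq x'_def)
    also have "\<dots> = (nrm m (x j) / S)\<^sup>2 + (1 - (nrm m (x j) / S)\<^sup>2)"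
      unfolding nrm_scale cS using le by (simp add: x'_def)
    finally show ?thesis using nrm_nonneg[of "Suc m" "x' j"] by (simp add: power2_eq_1_iff)
  qed
  from unit_columns_dominated[of "Suc m" n x', OF _ n unit] obtain l P Z where l: "l \<le> n\<^sup>2" "\<forall>i<l. 0 < P i" "torus_weights n {..<l::nat} P Z"
    and dom: "\<And>a. (kappa * nrm (Suc m) (\<lambda>k. \<Sum>j<n. a j * x' j k))\<^sup>2 \<le> torus_form n {..<l} P Z a" by auto
  have "(nrm m (\<lambda>k. \<Sum>j<n. a j * x j k))\<^sup>2 \<le> (1 / kappa * T)\<^sup>2 * torus_form n {..<l} P Z a" for a
  proof (cases "T > 0")
    case False
    then have "T = 0" using T by simp
    then have "x j k = 0" if "j < n" "k < m" for j k
      using xT that nrm_nonneg[of m "x j"] nrm_eq_0_iff[of m "x j"] by (simp add: order_antisym)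
    then have "nrm m (\<lambda>k. \<Sum>j<n. a j * x j k) = 0" by (auto simp: nrm_eq_0_iff intro!: sum.neutral)
    then show ?thesis using torus_form_nonneg[OF l(3)] by simp
  next
    case True
    then have ST: "S = T" by (simp add: S_def)
    have "(nrm m (\<lambda>k. \<Sum>j<n. a j * x j k) / S)\<^sup>2 = (nrm m (\<lambda>k. \<Sum>j<n. a j * x' j k))\<^sup>2"
    proof -
      have "nrm m (\<lambda>k. \<Sum>j<n. a j * x' j k) = nrm m (\<lambda>k. of_real (1 / S) * (\<Sum>j<n. a j * x j k))"
        by (rule nrm_cong) (simp add: x'_def sum_distrib_left mult_ac)
      then show ?thesis unfolding nrm_scale cS by simp
    qed
    also have "\<dots> \<le> (nrm (Suc m) (\<lambda>k. \<Sum>j<n. a j * x' j k))\<^sup>2"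
      by (simp add: nrm_sq)
    finally have "kappa\<^sup>2 * (nrm m (\<lambda>k. \<Sum>j<n. a j * x j k) / S)\<^sup>2
        \<le> kappa\<^sup>2 * (nrm (Suc m) (\<lambda>k. \<Sum>j<n. a j * x' j k))\<^sup>2"
      by (intro mult_left_mono) auto
    also have "\<dots> \<le> torus_form n {..<l} P Z a" using dom[of a] by (simp add: power_mult_distrib)
    finally have "kappa\<^sup>2 * (nrm m (\<lambda>k. \<Sum>j<n. a j * x j k) / T)\<^sup>2 \<le> torus_form n {..<l} P Z a"
      by (simp only: ST)
    then show ?thesis using True kappa_pos
      by (simp add: power_divide divide_le_eq pos_le_divide_eq mult_ac)
  qed
  then show "\<exists>l P Z. l \<le> n\<^sup>2 \<and> (\<forall>i<l. 0 < P i) \<and> torus_weights n {..<l::nat} P Z \<and>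
       (\<forall>a. (nrm m (\<lambda>k. \<Sum>j<n. a j * x j k))\<^sup>2 \<le> (1 / kappa * T)\<^sup>2 * torus_form n {..<l} P Z a)"
    using l by blast
qed

section \<open>The lower bound and attainment\<close>

text \<open>
  By duality: the norm of the combination \<open>h\<close> is its inner product with \<open>h / \<parallel>h\<parallel>\<close>.
\<close>

lemma nrm_le_of_weak_bound:
  fixes y :: "nat \<Rightarrow> nat \<Rightarrow> complex"
  assumes \<beta>: "\<And>\<xi>. (\<Sum>j<n. cmod (cdot N (y j) \<xi>)) \<le> \<beta> * nrm N \<xi>" and "0 \<le> \<beta>"
    and b: "\<And>j. j < n \<Longrightarrow> cmod (b j) = 1"
  shows "nrm N (\<lambda>k. \<Sum>j<n. b j * y j k) \<le> \<beta>"
proof -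
  define h where "h = (\<lambda>k. \<Sum>j<n. b j * y j k)"
  have "cdot N h h = (\<Sum>j<n. b j * cdot N (y j) h)"
    using cdot_sum_left[of N "\<lambda>j k. b j * y j k" "{..<n}" h] by (simp add: cdot_scale_left flip: h_def)
  then have "(nrm N h)\<^sup>2 = cmod (\<Sum>j<n. b j * cdot N (y j) h)"
    by (metis cdot_self norm_of_real abs_power2)
  also have "\<dots> \<le> (\<Sum>j<n. cmod (b j * cdot N (y j) h))" by (rule norm_sum)
  also have "\<dots> = (\<Sum>j<n. cmod (cdot N (y j) h))" using b by (simp add: norm_mult)
  also have "\<dots> \<le> \<beta> * nrm N h" by (rule \<beta>)
  finally have *: "nrm N h * nrm N h \<le> \<beta> * nrm N h" by (simp add: power2_eq_square)
  show ?thesis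
  proof (cases "nrm N h = 0")
    case True
    then show ?thesis using \<open>0 \<le> \<beta>\<close> by (simp add: h_def)
  next
    case False
    then have "nrm N h > 0" by (simp add: less_le)
    then show ?thesis using * by (simp add: h_def)
  qed
qed

text \<open>
  The coordinates of the normalised columns \<open>x\<^sub>j = y\<^sub>j / \<parallel>y\<^sub>j\<parallel>\<close> are tested against the vectors
  \<open>a\<^sub>k = (cnj y\<^sub>j\<^sub>k)\<^sub>j\<close>. The \<open>k\<close>-th coordinate of \<open>X a\<^sub>k\<close> is \<open>\<tau>\<^sub>k = \<Sum>\<^sub>j \<bar>y\<^sub>j\<^sub>k\<bar>\<^sup>2 / \<parallel>y\<^sub>j\<parallel>\<close>, and these numbers
  add up to \<open>\<Sum>\<^sub>j \<parallel>y\<^sub>j\<parallel>\<close>. On the other side, each atom of the dominating form contributes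
  \<open>\<parallel>\<Sum>\<^sub>j cnj z\<^sub>j y\<^sub>j\<parallel>\<^sup>2 \<le> \<beta>\<^sup>2\<close> to the sum over \<open>k\<close>.
\<close>

lemma dominates_lower_bound:
  fixes y :: "nat \<Rightarrow> nat \<Rightarrow> complex"
  assumes dom: "dominates n c" and c: "0 \<le> c" and N: "N \<ge> 1"
    and \<beta>: "\<And>\<xi>. (\<Sum>j<n. cmod (cdot N (y j) \<xi>)) \<le> \<beta> * nrm N \<xi>" and \<beta>0: "0 \<le> \<beta>"
  shows "(\<Sum>j<n. nrm N (y j)) \<le> sqrt N * c * \<beta>"
proof -
  define x where "x j k = of_real (1 / nrm N (y j)) * y j k" for j k
  have x1: "nrm N (x j) \<le> 1" for j
    unfolding x_def nrm_scale norm_of_real by simp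
  obtain l P Z where tw: "torus_weights n {..<l::nat} P Z"
    and d: "\<forall>a. (nrm N (\<lambda>k. \<Sum>j<n. a j * x j k))\<^sup>2 \<le> (c * 1)\<^sup>2 * torus_form n {..<l} P Z a"
    by (rule dominatesD[OF dom N x1]) (rule that)
  define a where "a k j = cnj (y j k)" for k j
  define \<tau> where "\<tau> k = (\<Sum>j<n. (cmod (y j k))\<^sup>2 / nrm N (y j))" for k
  have \<tau>_le: "(\<tau> k)\<^sup>2 \<le> c\<^sup>2 * torus_form n {..<l} P Z (a k)" if k: "k < N" for k
  proof -
    have "complex_of_real (\<tau> k) = (\<Sum>j<n. a k j * x j k)"
      unfolding \<tau>_def of_real_sum
    proof (rule sum.cong[OF refl])
      fix j
      have "complex_of_real ((cmod (y j k))\<^sup>2 / nrm N (y j)) = complex_of_real ((cmod (y j k))\<^sup>2) * of_real (1 / nrm N (y j))"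
        by simp
      then show "complex_of_real ((cmod (y j k))\<^sup>2 / nrm N (y j)) = a k j * x j k"
        unfolding complex_norm_square by (simp add: a_def x_def mult.commute)
    qed
    then have "cmod (\<Sum>j<n. a k j * x j k) = \<bar>\<tau> k\<bar>" by (simp flip: norm_of_real[where 'a=complex])
    then have "(\<tau> k)\<^sup>2 = (cmod (\<Sum>j<n. a k j * x j k))\<^sup>2" by simp
    also have "\<dots> \<le> (nrm N (\<lambda>k'. \<Sum>j<n. a k j * x j k'))\<^sup>2"
      unfolding nrm_sq using k by (intro member_le_sum[of k "{..<N}" "\<lambda>k'. (cmod (\<Sum>j<n. a k j * x j k'))\<^sup>2"]) auto
    also have "\<dots> \<le> c\<^sup>2 * torus_form n {..<l} P Z (a k)" using d by simp
    finally show ?thesis .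
  qed
  have "(\<Sum>k<N. torus_form n {..<l} P Z (a k)) = (\<Sum>i<l. P i * (nrm N (\<lambda>k. \<Sum>j<n. cnj (Z i j) * y j k))\<^sup>2)"
  proof -
    have "cmod (\<Sum>j<n. a k j * Z i j) = cmod (\<Sum>j<n. cnj (Z i j) * y j k)" for i k
    proof -
      have "(\<Sum>j<n. a k j * Z i j) = cnj (\<Sum>j<n. cnj (Z i j) * y j k)"
        by (simp add: a_def mult.commute)
      then show ?thesis by (metis complex_mod_cnj)
    qed
    then show ?thesis
      unfolding torus_form_def nrm_sq by (subst sum.swap) (simp add: sum_distrib_left)
  qed
  also have "\<dots> \<le> (\<Sum>i<l. P i * \<beta>\<^sup>2)"
    using tw by (intro sum_mono mult_left_mono power_mono nrm_le_of_weak_bound \<beta> \<beta>0)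
      (auto simp: torus_weights_def)
  also have "\<dots> = \<beta>\<^sup>2"
    using tw by (simp add: torus_weights_def flip: sum_distrib_right)
  finally have form_le: "(\<Sum>k<N. torus_form n {..<l} P Z (a k)) \<le> \<beta>\<^sup>2" .
  have "(\<Sum>k<N. \<tau> k) = (\<Sum>j<n. nrm N (y j))"
  proof -
    have "(\<Sum>k<N. \<tau> k) = (\<Sum>j<n. (nrm N (y j))\<^sup>2 / nrm N (y j))"
      unfolding \<tau>_def nrm_sq by (subst sum.swap) (simp add: sum_divide_distrib)
    then show ?thesis by (simp add: power2_eq_square)
  qed
  then have "(\<Sum>j<n. nrm N (y j))\<^sup>2 = (\<Sum>k<N. 1 * \<tau> k)\<^sup>2" by simp
  also have "\<dots> \<le> (\<Sum>k<N. 1\<^sup>2) * (\<Sum>k<N. (\<tau> k)\<^sup>2)" by (rule Cauchy_Schwarz_ineq_sum)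
  also have "\<dots> = N * (\<Sum>k<N. (\<tau> k)\<^sup>2)" by simp
  also have "\<dots> \<le> N * (\<Sum>k<N. c\<^sup>2 * torus_form n {..<l} P Z (a k))"
    by (intro mult_left_mono sum_mono \<tau>_le) auto
  also have "\<dots> \<le> N * (c\<^sup>2 * \<beta>\<^sup>2)"
    using form_le by (intro mult_left_mono) (auto simp flip: sum_distrib_left intro!: mult_left_mono)
  also have "\<dots> = (sqrt N * c * \<beta>)\<^sup>2" by (simp add: power_mult_distrib)
  finally show ?thesis
    using c \<beta>0 by (intro power2_le_imp_le[of "\<Sum>j<n. nrm N (y j)"]) auto
qed

text \<open>
  The columns are the sample points of the discretised Gaussian vector, scaled by their
  probabilities. The approximation error tends to 0 first, for fixed \<open>N\<close>, and then \<open>N\<close> tends to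
  infinity.
\<close>

lemma dominating_constants_lower_bound:
  assumes c: "\<And>n. n \<ge> 1 \<Longrightarrow> 0 \<le> c n \<and> dominates n (c n) \<and> c n \<le> S"
  shows "1 / kappa \<le> S"
proof -
  have "1 - 1 / (2 * real N) \<le> S * kappa" if N: "N \<ge> 1" for N
  proof -
    obtain V p e where V: "\<forall>m. finite (V m) \<and> (\<forall>v\<in>V m. 0 \<le> p m v) \<and> sum (p m) (V m) = 1"
      and e0: "e \<longlonglongrightarrow> 0"
      and e: "\<forall>m \<xi>. \<bar>(\<Sum>v\<in>V m. p m v * cmod (cdot N (gvec v) \<xi>)) - kappa * nrm N \<xi>\<bar> \<le> e m * nrm N \<xi>"
      and low: "\<forall>m. sqrt N * (1 - 1 / (2 * real N)) - e m \<le> (\<Sum>v\<in>V m. p m v * nrm N (gvec v))"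
      using gaussian_discretisation[OF N] by (elim exE conjE)
    have "sqrt N * (1 - 1 / (2 * real N)) - e m \<le> sqrt N * S * (kappa + \<bar>e m\<bar>)" for m
    proof -
      define n where "n = card (V m)"
      obtain g where g: "bij_betw g {..<n} (V m)"
        using V ex_bij_betw_nat_finite[of "V m"] by (auto simp: n_def atLeast0LessThan)
      have "V m \<noteq> {}" using V by (metis sum.empty zero_neq_one)
      then have n: "n \<ge> 1" using V by (simp add: n_def Suc_le_eq card_gt_0_iff)
      define y where "y j k = of_real (p m (g j)) * gvec (g j) k" for j k
      have pg: "0 \<le> p m (g j)" if "j < n" for j using V bij_betwE[OF g] that by auto
      have "(\<Sum>j<n. cmod (cdot N (y j) \<xi>)) \<le> (kappa + \<bar>e m\<bar>) * nrm N \<xi>" for \<xi>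
      proof -
        have "(\<Sum>j<n. cmod (cdot N (y j) \<xi>)) = (\<Sum>j<n. p m (g j) * cmod (cdot N (gvec (g j)) \<xi>))"
          unfolding y_def cdot_scale_left using pg by (intro sum.cong) (auto simp: norm_mult)
        also have "\<dots> = (\<Sum>v\<in>V m. p m v * cmod (cdot N (gvec v) \<xi>))"
          by (rule sum.reindex_bij_betw[OF g])
        also have "\<dots> \<le> kappa * nrm N \<xi> + e m * nrm N \<xi>" using spec[OF spec[OF e], of m \<xi>] by linarith
        also have "\<dots> \<le> (kappa + \<bar>e m\<bar>) * nrm N \<xi>" by (simp add: distrib_right mult_right_mono)
        finally show ?thesis .
      qed
      then have "(\<Sum>j<n. nrm N (y j)) \<le> sqrt N * c n * (kappa + \<bar>e m\<bar>)"
        using c[OF n] N kappa_pos by (intro dominates_lower_bound) auto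
      also have "\<dots> \<le> sqrt N * S * (kappa + \<bar>e m\<bar>)"
        using c[OF n] kappa_pos by (intro mult_right_mono mult_left_mono) auto
      also have "(\<Sum>j<n. nrm N (y j)) = (\<Sum>j<n. p m (g j) * nrm N (gvec (g j)))"
        unfolding y_def nrm_scale using pg by (intro sum.cong) auto
      also have "\<dots> = (\<Sum>v\<in>V m. p m v * nrm N (gvec v))" by (rule sum.reindex_bij_betw[OF g])
      finally show ?thesis using low by (meson order_trans)
    qed
    moreover have "(\<lambda>m. sqrt N * (1 - 1 / (2 * real N)) - e m) \<longlonglongrightarrow> sqrt N * (1 - 1 / (2 * real N)) - 0"
      by (intro tendsto_intros e0)
    moreover have "(\<lambda>m. sqrt N * S * (kappa + \<bar>e m\<bar>)) \<longlonglongrightarrow> sqrt N * S * (kappa + \<bar>0\<bar>)"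
      by (intro tendsto_intros e0)
    ultimately have "sqrt N * (1 - 1 / (2 * real N)) \<le> sqrt N * (S * kappa)"
      using LIMSEQ_le[of _ "sqrt N * (1 - 1 / (2 * real N)) - 0" _ "sqrt N * S * (kappa + \<bar>0\<bar>)"]
      by (auto simp: mult.assoc)
    then show ?thesis using N by simp
  qed
  moreover have "(\<lambda>N. 1 - 1 / (2 * real N)) \<longlonglongrightarrow> 1" by real_asymp
  ultimately have "1 \<le> S * kappa"
    by (intro LIMSEQ_le_const2[of "\<lambda>N. 1 - 1 / (2 * real N)"]) auto
  then show ?thesis using kappa_pos by (simp add: pos_divide_le_eq)
qed

text \<open>
  Tested on the matrix with one row, all of whose entries are 1, at the first unit vector.
\<close>

lemma dominates_constant_ge_one:
  assumes "dominates n c" "n \<ge> 1"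
  shows "1 \<le> c\<^sup>2"
proof -
  have one: "nrm 1 (\<lambda>_. 1) \<le> 1" by (simp add: nrm_def L2_set_def)
  obtain l P Z where tw: "torus_weights n {..<l::nat} P Z"
    and d: "\<forall>a. (nrm 1 (\<lambda>_. \<Sum>j<n. a j * 1))\<^sup>2 \<le> (c * 1)\<^sup>2 * torus_form n {..<l} P Z a"
    by (rule dominatesD[OF assms(1) order_refl one]) (rule that)
  let ?a = "\<lambda>j. if j = 0 then 1 else 0 :: complex"
  have "(\<Sum>j<n. ?a j) = 1" using assms(2) by (subst sum.delta) auto
  then have "1 \<le> c\<^sup>2 * torus_form n {..<l} P Z ?a"
    using spec[OF d, of ?a] by (simp add: nrm_def L2_set_def)
  also have "torus_form n {..<l} P Z ?a = 1"
    using torus_form_unit[OF assms(2), of "{..<l}" Z P] tw by (simp add: torus_weights_def)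
  finally show ?thesis by simp
qed

text \<open>
  The constants converge, and the dominating forms have a convergent subsequence.
\<close>

lemma dominates_limit:
  assumes n: "n \<ge> 1" and d: "\<And>k. dominates n (c k)" and lim: "c \<longlonglongrightarrow> c0"
  shows "dominates n c0"
  unfolding dominates_def
proof (intro allI impI)
  fix m :: nat and x :: "nat \<Rightarrow> nat \<Rightarrow> complex" and T
  assume m: "m \<ge> 1" and xT: "\<forall>j<n. nrm m (x j) \<le> T"
  let ?w = "\<lambda>a. (nrm m (\<lambda>k. \<Sum>j<n. a j * x j k))\<^sup>2"
  define good where "good k l P Z \<longleftrightarrow> torus_weights n {..<l::nat} P Z \<and>
    (\<forall>a. ?w a \<le> (c k * T)\<^sup>2 * torus_form n {..<l} P Z a)" for k l P Z
  have "\<exists>l P Z. good k l P Z" for k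
  proof -
    have xT': "nrm m (x j) \<le> T" if "j < n" for j using xT that by simp
    obtain l P Z where "torus_weights n {..<l::nat} P Z" "\<forall>a. ?w a \<le> (c k * T)\<^sup>2 * torus_form n {..<l} P Z a"
      by (rule dominatesD[of n "c k" m x T, OF d m xT']) (assumption, rule that)
    then have "good k l P Z" unfolding good_def by (rule conjI)
    then show ?thesis by (intro exI)
  qed
  then obtain l P Z where good: "good k (l k) (P k) (Z k)" for k by metis
  have tw: "torus_weights n {..<l k} (P k) (Z k)" for k
    using good[of k] by (simp only: good_def)
  have dom: "?w a \<le> (c k * T)\<^sup>2 * torus_form n {..<l k} (P k) (Z k) a" for k a
    using good[of k] by (simp only: good_def)
  obtain l0 P0 Z0 r where r: "l0 \<le> n\<^sup>2" "\<forall>i<l0. 0 < P0 i" "torus_weights n {..<l0::nat} P0 Z0" "strict_mono r"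
    and form: "\<forall>a. (\<lambda>k. torus_form n {..<l (r k)} (P (r k)) (Z (r k)) a) \<longlonglongrightarrow> torus_form n {..<l0} P0 Z0 a"
    using torus_form_limit[of n "\<lambda>k. {..<l k}" P Z, OF n tw] by blast
  have "?w a \<le> (c0 * T)\<^sup>2 * torus_form n {..<l0} P0 Z0 a" for a
  proof (rule LIMSEQ_le_const)
    show "(\<lambda>k. (c (r k) * T)\<^sup>2 * torus_form n {..<l (r k)} (P (r k)) (Z (r k)) a)
        \<longlonglongrightarrow> (c0 * T)\<^sup>2 * torus_form n {..<l0} P0 Z0 a"
      using LIMSEQ_subseq_LIMSEQ[OF lim r(4)] form by (intro tendsto_intros) (auto simp: o_def)
  qed (use dom in auto)
  then show "\<exists>l P Z. l \<le> n\<^sup>2 \<and> (\<forall>i<l. 0 < P i) \<and> torus_weights n {..<l::nat} P Z \<and>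
       (\<forall>a. ?w a \<le> (c0 * T)\<^sup>2 * torus_form n {..<l} P Z a)"
    by (intro exI[of _ l0] exI[of _ P0] exI[of _ Z0]) (use r in simp)
qed

section \<open>From dominated forms to matrix factorisations\<close>

lemma l2_norm_vec_nrm: "l2_norm_vec v = nrm (dim_vec v) (\<lambda>i. vec_index v i)"
  by (simp add: l2_norm_vec_def nrm_def)

lemma mult_mat_vec_nth:
  assumes "C \<in> carrier_mat m l" "k < m" "dim_vec v = l"
  shows "vec_index (C *\<^sub>v v) k = (\<Sum>i<l. C $$ (k, i) * vec_index v i)"
  using assms by (auto simp: scalar_prod_def atLeast0LessThan intro!: sum.cong)

lemma l2_norm_mult_vec:
  assumes "C \<in> carrier_mat m l" "dim_vec v = l"
  shows "l2_norm_vec (C *\<^sub>v v) = nrm m (\<lambda>k. \<Sum>i<l. C $$ (k, i) * vec_index v i)"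
  using assms mult_mat_vec_nth[OF assms(1) _ assms(2)]
  by (auto simp: l2_norm_vec_nrm intro!: nrm_cong)

lemma op_norm_mat_le:
  assumes C: "C \<in> carrier_mat m l"
    and bound: "\<And>v. nrm m (\<lambda>k. \<Sum>i<l. C $$ (k, i) * v i) \<le> K * nrm l v" and "0 \<le> K"
  shows "op_norm_mat C \<le> K"
  unfolding op_norm_mat_def
proof (rule cSUP_least)
  show "{v \<in> carrier_vec (dim_col C). l2_norm_vec v \<le> 1} \<noteq> {}"
    by (auto intro!: exI[of _ "0\<^sub>v (dim_col C)"] simp: l2_norm_vec_nrm nrm_def L2_set_def)
next
  fix v assume v: "v \<in> {v \<in> carrier_vec (dim_col C). l2_norm_vec v \<le> 1}"
  then have l: "dim_vec v = l" using C by auto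
  have "l2_norm_vec (C *\<^sub>v v) \<le> K * nrm l (vec_index v)"
    using bound[of "vec_index v"] by (simp add: l2_norm_mult_vec[OF C l])
  also have "\<dots> \<le> K * 1"
    using v l \<open>0 \<le> K\<close> by (intro mult_left_mono) (auto simp: l2_norm_vec_nrm)
  finally show "l2_norm_vec (C *\<^sub>v v) \<le> K" by simp
qed

text \<open>
  The supremum is finite, because the sum of the moduli of all entries bounds it; the estimate then
  follows by scaling \<open>v\<close> to norm 1.
\<close>

lemma nrm_apply_le_op_norm:
  assumes C: "C \<in> carrier_mat m l"
  shows "nrm m (\<lambda>k. \<Sum>i<l. C $$ (k, i) * v i) \<le> op_norm_mat C * nrm l v"
proof -
  let ?B = "{v \<in> carrier_vec (dim_col C). l2_norm_vec v \<le> 1}"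
  let ?S = "\<Sum>k<m. \<Sum>i<l. cmod (C $$ (k, i))"
  have bdd: "bdd_above ((\<lambda>v. l2_norm_vec (C *\<^sub>v v)) ` ?B)"
  proof (rule bdd_aboveI2)
    fix w assume w: "w \<in> ?B"
    then have l: "dim_vec w = l" using C by auto
    have le1: "cmod (vec_index w i) \<le> 1" if "i < l" for i
    proof -
      have "cmod (vec_index w i) \<le> L2_set (\<lambda>i. cmod (vec_index w i)) {..<l}"
        using that by (intro member_le_L2_set) auto
      then show ?thesis using w l by (simp add: l2_norm_vec_def)
    qed
    have "l2_norm_vec (C *\<^sub>v w) \<le> (\<Sum>k<m. cmod (\<Sum>i<l. C $$ (k, i) * vec_index w i))"
      unfolding l2_norm_mult_vec[OF C l] nrm_def by (rule L2_set_le_sum) simp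
    also have "\<dots> \<le> ?S"
    proof (intro sum_mono)
      fix k
      have "cmod (\<Sum>i<l. C $$ (k, i) * vec_index w i) \<le> (\<Sum>i<l. cmod (C $$ (k, i) * vec_index w i))"
        by (rule norm_sum)
      also have "\<dots> \<le> (\<Sum>i<l. cmod (C $$ (k, i)))"
        using le1 by (intro sum_mono) (simp add: norm_mult mult_left_le)
      finally show "cmod (\<Sum>i<l. C $$ (k, i) * vec_index w i) \<le> (\<Sum>i<l. cmod (C $$ (k, i)))" .
    qed
    finally show "l2_norm_vec (C *\<^sub>v w) \<le> ?S" .
  qed
  show ?thesis
  proof (cases "nrm l v = 0")
    case True
    then have "\<forall>i<l. v i = 0" by (simp add: nrm_eq_0_iff)
    then have "nrm m (\<lambda>k. \<Sum>i<l. C $$ (k, i) * v i) = 0" by (simp add: nrm_eq_0_iff)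
    then show ?thesis using True by simp
  next
    case False
    then have pos: "nrm l v > 0" by (simp add: less_le)
    define w where "w = Matrix.vec l (\<lambda>i. of_real (1 / nrm l v) * v i)"
    have cn: "cmod (of_real (1 / nrm l v)) = 1 / nrm l v" unfolding norm_of_real by simp
    have "l2_norm_vec w = nrm l (\<lambda>i. of_real (1 / nrm l v) * v i)"
      unfolding l2_norm_vec_nrm w_def by (auto intro!: nrm_cong)
    also have "\<dots> = 1" unfolding nrm_scale cn using pos by simp
    finally have "w \<in> ?B" using C by (auto simp: w_def)
    then have "l2_norm_vec (C *\<^sub>v w) \<le> op_norm_mat C"
      unfolding op_norm_mat_def by (rule cSUP_upper[OF _ bdd])
    also have "l2_norm_vec (C *\<^sub>v w) = nrm m (\<lambda>k. of_real (1 / nrm l v) * (\<Sum>i<l. C $$ (k, i) * v i))"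
      by (subst l2_norm_mult_vec[OF C]) (auto simp: w_def sum_distrib_left mult_ac intro!: nrm_cong)
    also have "\<dots> = nrm m (\<lambda>k. \<Sum>i<l. C $$ (k, i) * v i) / nrm l v" unfolding nrm_scale cn by simp
    finally show ?thesis using pos by (simp add: pos_divide_le_eq)
  qed
qed

lemma factor_entry:
  assumes "C \<in> carrier_mat m l" "\<Lambda> \<in> carrier_vec l" "Z \<in> carrier_mat l n" "k < m" "j < n"
  shows "(C * Delta \<Lambda> * Z) $$ (k, j) = (\<Sum>i<l. C $$ (k, i) * (vec_index \<Lambda> i * Z $$ (i, j)))"
proof -
  have D: "Delta \<Lambda> \<in> carrier_mat l l" using assms by (simp add: Delta_def)
  have "C * Delta \<Lambda> = Matrix.mat m l (\<lambda>(k, i). C $$ (k, i) * vec_index \<Lambda> i)"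
    unfolding Delta_def using assms mat_diag_mult_right[of C m l "vec_index \<Lambda>"] by simp
  then show ?thesis using assms D
    by (auto simp: scalar_prod_def atLeast0LessThan mult.assoc intro!: sum.cong)
qed

lemma column_norm_ge:
  assumes "X \<in> carrier_mat m n" "j < n"
  shows "nrm m (\<lambda>k. X $$ (k, j)) \<le> column_norm X"
proof -
  have "nrm m (\<lambda>k. X $$ (k, j)) = l2_norm_vec (col X j)"
    using assms by (auto simp: l2_norm_vec_nrm intro!: nrm_cong)
  then show ?thesis unfolding column_norm_def using assms by (auto intro!: Max_ge)
qed

lemma column_norm_le:
  assumes "X \<in> carrier_mat m n" "n \<ge> 1" "\<And>j. j < n \<Longrightarrow> nrm m (\<lambda>k. X $$ (k, j)) \<le> T"
  shows "column_norm X \<le> T"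
proof -
  have "nrm m (\<lambda>k. X $$ (k, j)) = l2_norm_vec (col X j)" if "j < n" for j
    using assms(1) that by (auto simp: l2_norm_vec_nrm intro!: nrm_cong)
  then show ?thesis unfolding column_norm_def using assms by (subst Max_le_iff) (auto simp: lessThan_empty_iff)
qed

text \<open>
  The squared entries of \<open>\<Lambda>\<close> are the weights of the form, and its value at \<open>a\<close> is the squared norm of
  \<open>w = \<Delta>(\<Lambda>) Z a\<close>, which \<open>C\<close> maps to \<open>X a\<close>.
\<close>

lemma factorization_imp_dominates:
  assumes c: "0 \<le> c" and n: "n \<ge> 1" and fc: "factorization_constant n c"
  shows "dominates n c"
  unfolding dominates_def
proof (intro allI impI)
  fix m :: nat and x :: "nat \<Rightarrow> nat \<Rightarrow> complex" and T
  assume m: "m \<ge> 1" and xT: "\<forall>j<n. nrm m (x j) \<le> T"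
  define X where "X = Matrix.mat m n (\<lambda>(k, j). x j k)"
  have X: "X \<in> carrier_mat m n" by (simp add: X_def)
  obtain l C \<Lambda> Z where l: "l \<le> n\<^sup>2" and C: "C \<in> carrier_mat m l" and \<Lambda>: "\<Lambda> \<in> carrier_vec l"
    and Z: "Z \<in> torus_mat l n" and op: "op_norm_mat C \<le> c * column_norm X"
    and unit: "l2_norm_vec \<Lambda> = 1" and pos: "positive_vec \<Lambda>" and fac: "X = C * Delta \<Lambda> * Z"
    using fc m X unfolding factorization_constant_def by meson
  have Zc: "Z \<in> carrier_mat l n" using Z by (simp add: torus_mat_def)
  define P where "P i = (cmod (vec_index \<Lambda> i))\<^sup>2" for i
  define z where "z i j = Z $$ (i, j)" for i j
  have "\<forall>i<l. 0 < P i"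
    using pos \<Lambda> by (auto simp: P_def positive_vec_def)
  moreover have "torus_weights n {..<l} P z"
  proof -
    have "sum P {..<l} = (nrm l (vec_index \<Lambda>))\<^sup>2" by (simp add: nrm_sq P_def)
    also have "\<dots> = 1" using unit \<Lambda> by (simp add: l2_norm_vec_nrm)
    finally show ?thesis using Z by (auto simp: torus_weights_def P_def z_def torus_mat_def)
  qed
  moreover have "(nrm m (\<lambda>k. \<Sum>j<n. a j * x j k))\<^sup>2 \<le> (c * T)\<^sup>2 * torus_form n {..<l} P z a" for a
  proof -
    define w where "w i = vec_index \<Lambda> i * (\<Sum>j<n. a j * z i j)" for i
    have "(\<Sum>j<n. a j * x j k) = (\<Sum>i<l. C $$ (k, i) * w i)" if k: "k < m" for k
    proof -
      have "x j k = (\<Sum>i<l. C $$ (k, i) * (vec_index \<Lambda> i * z i j))" if j: "j < n" for j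
        using factor_entry[OF C \<Lambda> Zc k j] j k unfolding fac[symmetric] by (simp add: X_def z_def)
      then have "(\<Sum>j<n. a j * x j k) = (\<Sum>j<n. \<Sum>i<l. a j * (C $$ (k, i) * (vec_index \<Lambda> i * z i j)))"
        by (simp add: sum_distrib_left)
      also have "\<dots> = (\<Sum>i<l. C $$ (k, i) * w i)"
        by (subst sum.swap) (simp add: w_def sum_distrib_left mult_ac)
      finally show ?thesis .
    qed
    then have "nrm m (\<lambda>k. \<Sum>j<n. a j * x j k) = nrm m (\<lambda>k. \<Sum>i<l. C $$ (k, i) * w i)"
      by (intro nrm_cong) auto
    also have "\<dots> \<le> op_norm_mat C * nrm l w" by (rule nrm_apply_le_op_norm[OF C])
    also have "\<dots> \<le> (c * T) * nrm l w"
    proof -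
      have "column_norm X \<le> T" using xT by (intro column_norm_le[OF X n]) (simp add: X_def cong: nrm_cong)
      then have "op_norm_mat C \<le> c * T" using op c by (meson mult_left_mono order_trans)
      then show ?thesis by (intro mult_right_mono) auto
    qed
    finally have "(nrm m (\<lambda>k. \<Sum>j<n. a j * x j k))\<^sup>2 \<le> ((c * T) * nrm l w)\<^sup>2"
      by (intro power_mono) auto
    also have "\<dots> = (c * T)\<^sup>2 * torus_form n {..<l} P z a"
      by (simp add: power_mult_distrib nrm_sq torus_form_def w_def P_def norm_mult)
    finally show ?thesis .
  qed
  ultimately show "\<exists>l P Z. l \<le> n\<^sup>2 \<and> (\<forall>i<l. 0 < P i) \<and> torus_weights n {..<l::nat} P Z \<and>
       (\<forall>a. (nrm m (\<lambda>k. \<Sum>j<n. a j * x j k))\<^sup>2 \<le> (c * T)\<^sup>2 * torus_form n {..<l} P Z a)"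
    using l by (intro exI[of _ l] exI[of _ P] exI[of _ z]) simp
qed

text \<open>
  With \<open>Y = \<Delta>(\<Lambda>) Z\<close> and the generalised inverse \<open>\<beta>\<close> of \<open>Y\<close>, put \<open>C = X \<beta>\<close>. Domination
  bounds \<open>\<parallel>X \<beta> v\<parallel>\<close> by \<open>\<parallel>Y \<beta> v\<parallel> \<le> \<parallel>v\<parallel>\<close> up to the constant. It also gives \<open>X \<beta> Y = X\<close>,
  since \<open>Y\<close> vanishes on the columns of \<open>\<beta> Y - 1\<close> and hence so does \<open>X\<close>.
\<close>

lemma dominates_imp_factorization:
  assumes c: "0 \<le> c" and n: "n \<ge> 1" and dom: "dominates n c"
  shows "factorization_constant n c"
  unfolding factorization_constant_def
proof (intro allI impI ballI)
  fix m :: nat and X :: "complex mat" assume m: "m \<ge> 1" and X: "X \<in> carrier_mat m n"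
  define T where "T = column_norm X"
  define x where "x j = (\<lambda>k. X $$ (k, j))" for j
  have xT: "nrm m (x j) \<le> T" if "j < n" for j
    using column_norm_ge[OF X that] by (simp add: T_def x_def)
  have T0: "0 \<le> T" using xT[of 0] n nrm_nonneg[of m "x 0"] by linarith
  obtain l P z where l: "l \<le> n\<^sup>2" and P: "\<forall>i<l. 0 < P i" and tw: "torus_weights n {..<l::nat} P z"
    and d: "\<forall>a. (nrm m (\<lambda>k. \<Sum>j<n. a j * x j k))\<^sup>2 \<le> (c * T)\<^sup>2 * torus_form n {..<l} P z a"
    by (rule dominatesD[of n c m x T, OF dom m xT]) (assumption, rule that)
  define y where "y j i = of_real (sqrt (P i)) * z i j" for j i
  have form: "torus_form n {..<l} P z a = (nrm l (\<lambda>i. \<Sum>j<n. a j * y j i))\<^sup>2" for a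
  proof -
    have "(cmod (\<Sum>j<n. a j * y j i))\<^sup>2 = P i * (cmod (\<Sum>j<n. a j * z i j))\<^sup>2" if "i < l" for i
    proof -
      have "(\<Sum>j<n. a j * y j i) = of_real (sqrt (P i)) * (\<Sum>j<n. a j * z i j)"
        by (simp add: y_def sum_distrib_left mult_ac)
      then show ?thesis using P that by (simp add: norm_mult power_mult_distrib less_imp_le)
    qed
    then show ?thesis by (simp add: torus_form_def nrm_sq)
  qed
  have dy: "nrm m (\<lambda>k. \<Sum>j<n. a j * x j k) \<le> c * T * nrm l (\<lambda>i. \<Sum>j<n. a j * y j i)" for a
    by (rule power2_le_imp_le) (use d form c T0 in \<open>auto simp: power_mult_distrib\<close>)
  obtain \<beta> where \<beta>1: "\<forall>q<n. \<forall>i<l. (\<Sum>j<n. (\<Sum>i'<l. \<beta> j i' * y q i') * y j i) = y q i"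
    and \<beta>2: "\<forall>v. nrm l (\<lambda>i. \<Sum>j<n. (\<Sum>i'<l. \<beta> j i' * v i') * y j i) \<le> nrm l v"
    using contractive_generalized_inverse[of n l y] by (elim exE conjE)
  define C where "C = Matrix.mat m l (\<lambda>(k, i). \<Sum>j<n. x j k * \<beta> j i)"
  define \<Lambda> where "\<Lambda> = Matrix.vec l (\<lambda>i. complex_of_real (sqrt (P i)))"
  define Z where "Z = Matrix.mat l n (\<lambda>(i, j). z i j)"
  have C: "C \<in> carrier_mat m l" and \<Lambda>: "\<Lambda> \<in> carrier_vec l" and Zc: "Z \<in> carrier_mat l n"
    by (simp_all add: C_def \<Lambda>_def Z_def)
  have Z: "Z \<in> torus_mat l n" using tw by (simp add: torus_mat_def torus_weights_def Z_def)
  have C_apply: "(\<Sum>i<l. C $$ (k, i) * v i) = (\<Sum>j<n. (\<Sum>i<l. \<beta> j i * v i) * x j k)" if "k < m" for k v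
  proof -
    have "(\<Sum>i<l. C $$ (k, i) * v i) = (\<Sum>i<l. \<Sum>j<n. \<beta> j i * v i * x j k)"
      using that by (simp add: C_def sum_distrib_right sum_distrib_left mult_ac)
    then show ?thesis by (subst (asm) sum.swap) (simp add: sum_distrib_right)
  qed
  have "op_norm_mat C \<le> c * T"
  proof (rule op_norm_mat_le[OF C])
    fix v
    have "nrm m (\<lambda>k. \<Sum>i<l. C $$ (k, i) * v i) = nrm m (\<lambda>k. \<Sum>j<n. (\<Sum>i<l. \<beta> j i * v i) * x j k)"
      by (intro nrm_cong C_apply)
    also have "\<dots> \<le> c * T * nrm l (\<lambda>i. \<Sum>j<n. (\<Sum>i'<l. \<beta> j i' * v i') * y j i)" by (rule dy)
    also have "\<dots> \<le> c * T * nrm l v" using \<beta>2 c T0 by (intro mult_left_mono) auto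
    finally show "nrm m (\<lambda>k. \<Sum>i<l. C $$ (k, i) * v i) \<le> c * T * nrm l v" .
  qed (use c T0 in simp)
  moreover have "l2_norm_vec \<Lambda> = 1"
  proof -
    have "(l2_norm_vec \<Lambda>)\<^sup>2 = (\<Sum>i<l. P i)"
      using P by (simp add: l2_norm_vec_nrm nrm_sq \<Lambda>_def less_imp_le)
    also have "\<dots> = 1" using tw by (simp add: torus_weights_def)
    finally show ?thesis by (simp add: power2_eq_1_iff l2_norm_vec_nrm) (smt (verit) nrm_nonneg)
  qed
  moreover have "positive_vec \<Lambda>" using P by (simp add: positive_vec_def \<Lambda>_def)
  moreover have "X = C * Delta \<Lambda> * Z"
  proof (rule eq_matI)
    fix k q assume "k < dim_row (C * Delta \<Lambda> * Z)" "q < dim_col (C * Delta \<Lambda> * Z)"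
    then have k: "k < m" and q: "q < n" using C Zc by auto
    define b where "b j = (\<Sum>i<l. \<beta> j i * y q i)" for j
    \<comment> \<open>column q of the matrix \<open>\<beta> Y - 1\<close>\<close>
    define a where "a j = b j - (if j = q then 1 else 0)" for j
    have split: "(\<Sum>j<n. a j * u j) = (\<Sum>j<n. b j * u j) - u q" for u
    proof -
      have "(\<Sum>j<n. (if j = q then 1 else 0) * u j) = u q"
        using q by (subst sum.remove[of _ q]) auto
      then show ?thesis by (simp add: a_def left_diff_distrib sum_subtractf)
    qed
    have "nrm l (\<lambda>i. \<Sum>j<n. a j * y j i) = 0"
      using \<beta>1 q by (auto simp: nrm_eq_0_iff split b_def)
    then have "nrm m (\<lambda>k. \<Sum>j<n. a j * x j k) = 0"
      using dy[of a] nrm_nonneg[of m] by (simp add: order_antisym)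
    then have "(\<Sum>j<n. b j * x j k) = x q k"
      using k by (auto simp: nrm_eq_0_iff split)
    moreover have "(C * Delta \<Lambda> * Z) $$ (k, q) = (\<Sum>i<l. C $$ (k, i) * y q i)"
      unfolding factor_entry[OF C \<Lambda> Zc k q] using q by (simp add: y_def \<Lambda>_def Z_def)
    ultimately show "X $$ (k, q) = (C * Delta \<Lambda> * Z) $$ (k, q)"
      using C_apply[OF k, of "y q"] by (simp add: b_def x_def)
  qed (use X C Zc in auto)
  ultimately show "\<exists>l \<le> n\<^sup>2. \<exists>C \<in> carrier_mat m l. \<exists>\<Lambda> \<in> carrier_vec l. \<exists>Z \<in> torus_mat l n.
          op_norm_mat C \<le> c * column_norm X \<and>
          l2_norm_vec \<Lambda> = 1 \<and> positive_vec \<Lambda> \<and> X = C * Delta \<Lambda> * Z"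
    unfolding T_def
    by (intro exI[of _ l] conjI bexI[of _ C] bexI[of _ \<Lambda>] bexI[of _ Z] l C \<Lambda> Z)
qed

section \<open>The optimal constants\<close>

theorem theorem2p2:
  shows "\<exists>c :: nat \<Rightarrow> real.
    (\<forall>n\<ge>1. 0 < c n \<and> factorization_constant n (c n) \<and>
            (\<forall>d>0. factorization_constant n d \<longrightarrow> c n \<le> d) \<and>
            c n \<le> sqrt kGC) \<and>
    (SUP n\<in>{1..}. c n) = sqrt kGC"
proof -
  have kGC: "sqrt kGC = 1 / kappa"
    by (simp add: kGC_def kappa_def real_sqrt_divide)
  have iff: "factorization_constant n d \<longleftrightarrow> dominates n d" if "n \<ge> 1" "d > 0" for n d
    using factorization_imp_dominates[of d n] dominates_imp_factorization[of d n] that by auto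
  define A where "A n = {d. 0 < d \<and> dominates n d}" for n
  define c where "c n = Inf (A n)" for n
  have upper: "1 / kappa \<in> A n" if "n \<ge> 1" for n
    using dominates_inverse_kappa[OF that] kappa_pos by (simp add: A_def)
  have ge1: "1 \<le> d" if "n \<ge> 1" "d \<in> A n" for n d
    using dominates_constant_ge_one[of n d] that by (simp add: A_def) (smt (verit) one_le_power power2_le_imp_le power_one)
  have bdd: "bdd_below (A n)" for n by (rule bdd_belowI[of _ 0]) (simp add: A_def)
  have c1: "1 \<le> c n" if "n \<ge> 1" for n
    unfolding c_def using upper[OF that] ge1[OF that] by (intro cInf_greatest) auto
  have c_le: "c n \<le> d" if "d \<in> A n" for n d
    unfolding c_def using that bdd by (rule cInf_lower)
  have c_dom: "dominates n (c n)" if n: "n \<ge> 1" for n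
  proof -
    have "\<exists>d\<in>A n. d < c n + 1 / real (Suc k)" for k
    proof -
      have "Inf (A n) < c n + 1 / real (Suc k)" by (simp add: c_def)
      then show ?thesis using cInf_lessD[of "A n"] upper[OF n] by auto
    qed
    then obtain d where d: "\<And>k. d k \<in> A n" "\<And>k. d k < c n + 1 / real (Suc k)" by metis
    have dd: "dominates n (d k)" for k using d(1)[of k] by (simp add: A_def)
    have "d \<longlonglongrightarrow> c n"
    proof (rule real_tendsto_sandwich)
      show "\<forall>\<^sub>F k in sequentially. c n \<le> d k" using c_le[OF d(1)] by simp
      show "\<forall>\<^sub>F k in sequentially. d k \<le> c n + 1 / real (Suc k)"
        using d(2) by (intro always_eventually allI less_imp_le)
      show "(\<lambda>k. c n) \<longlonglongrightarrow> c n" by (rule tendsto_const)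
      show "(\<lambda>k. c n + 1 / real (Suc k)) \<longlonglongrightarrow> c n"
        using tendsto_add[OF tendsto_const LIMSEQ_Suc[OF lim_1_over_n], of "c n"] by simp
    qed
    then show ?thesis by (rule dominates_limit[OF n dd])
  qed
  have "(SUP n\<in>{1..}. c n) = 1 / kappa"
  proof (rule antisym)
    show "(SUP n\<in>{1..}. c n) \<le> 1 / kappa"
      by (rule cSUP_least) (auto intro!: c_le upper)
    have "bdd_above (c ` {1..})"
      by (rule bdd_aboveI2[of _ _ "1 / kappa"]) (auto intro!: c_le upper)
    then show "1 / kappa \<le> (SUP n\<in>{1..}. c n)"
      by (intro dominating_constants_lower_bound[of c])
         (use c1 c_dom in \<open>force intro: cSUP_upper order_trans[OF zero_le_one]\<close>)
  qed
  moreover have "0 < c n \<and> factorization_constant n (c n) \<and>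
            (\<forall>d>0. factorization_constant n d \<longrightarrow> c n \<le> d) \<and> c n \<le> 1 / kappa" if n: "n \<ge> 1" for n
    using c1[OF n] c_dom[OF n] iff[OF n] c_le upper[OF n] by (auto simp: A_def)
  ultimately show ?thesis unfolding kGC by (intro exI[of _ c]) auto
qed

end
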